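(* Let $\mathfrak k\subset\mathfrak{gl}(V,V_* )$ be any subalgebra. Then there exists a taut couple $\mathfrak F,\mathfrak G$ with $\mathfrak k\subset\mathrm{St}_{\mathfrak F}\cap\mathrm{St}_{\mathfrak G}$ such that for every $\gamma\in C$ the quotients $F''_\gamma/F'_\gamma$ and $G''_\gamma/G'_\gamma$ are irreducible $\mathfrak k$-modules, and moreover $$\mathfrak n_{\mathfrak k}=\mathfrak n_{\mathrm{St}_{\mathfrak F}\cap\mathrm{St}_{\mathfrak G}}\cap\mathfrak k.$$
   Context: $V,V_*$: countable-dimensional complex spaces with nondegenerate pairing; $\mathfrak{gl}(V,V_* )=V\otimes V_*$ (Lie algebra of the associative algebra with $(v\otimes w)(v'\otimes w')=\langle v',w\rangle v\otimes w'$), acting on $V$ by $(v\otimes w)u=\langle u,w\rangle v$ and on $V_*$ by $(v\otimes w)y=-\langle v,y\rangle w$. Orthogonal complement $F^\perp$; closed: $F=F^{\perp\perp}$; $\overline F=F^{\perp\perp}$. Generalized flag: chain of subspaces, every member in an immediate predecessor–successor pair $F'\subsetneq F''$, every nonzero vector in $F''\setminus F'$ for some pair; pairs of $\mathfrak F$ indexed by $A$, of $\mathfrak G$ by $B$. Semiclosed: $\overline{F'}\in\{F',F''\}$ for every pair. $\mathrm{St}$ = stabilizer in $\mathfrak{gl}(V,V_* )$. Taut couple: semiclosed $\mathfrak F$ in $V$, $\mathfrak G$ in $V_*$ with $\mathfrak F^\perp$ stable under $\mathrm{St}_{\mathfrak G}$ and $\mathfrak G^\perp$ stable under $\mathrm{St}_{\mathfrak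 F}$. For a taut couple, the pairs $\alpha$ of $\mathfrak F$ with $F'_\alpha$ closed are in bijection with the pairs $\beta$ of $\mathfrak G$ with $G'_\beta$ closed via $G'_\beta=(F''_\alpha)^\perp$ (then also $(G''_\beta)^\perp=F'_\alpha$); this common index set is $C$, with corresponding pairs written $F'_\gamma\subset F''_\gamma$, $G'_\gamma\subset G''_\gamma$. Linear nilradical $\mathfrak n_{\mathfrak k}$ of $\mathfrak k\subset\mathfrak{gl}(V,V_* )$: elements of the largest locally solvable ideal of $\mathfrak k$ that are nilpotent endomorphisms of $V$. *)

theory Defs
  imports Complex_Main "HOL-Library.Countable_Set"
begin

text \<open>Elements of gl(V,V_*) = V (x) V_* are represented faithfully by their pair of
actions (on V and on V_*).  The map V (x) V_* -> End(V) is injective because the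
pairing is nondegenerate, so this is just the image of the tensor product.\<close>

type_synonym ('v,'w) glel = "('v \<Rightarrow> 'v) \<times> ('w \<Rightarrow> 'w)"

definition tensor_action ::
  "(complex \<Rightarrow> 'v::ab_group_add \<Rightarrow> 'v) \<Rightarrow> (complex \<Rightarrow> 'w::ab_group_add \<Rightarrow> 'w)
    \<Rightarrow> ('v \<Rightarrow> 'w \<Rightarrow> complex) \<Rightarrow> ('v \<times> 'w) list \<Rightarrow> ('v,'w) glel" where
  "tensor_action sV sW p ts =
     ((\<lambda>u. \<Sum>(v,w)\<leftarrow>ts. sV (p u w) v), (\<lambda>y. - (\<Sum>(v,w)\<leftarrow>ts. sW (p v y) w)))"

definition glVV ::
  "(complex \<Rightarrow> 'v::ab_group_add \<Rightarrow> 'v) \<Rightarrow> (complex \<Rightarrow> 'w::ab_group_add \<Rightarrow> 'w)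
    \<Rightarrow> ('v \<Rightarrow> 'w \<Rightarrow> complex) \<Rightarrow> ('v,'w) glel set" where
  "glVV sV sW p = range (tensor_action sV sW p)"

definition gl_zero :: "('v::ab_group_add,'w::ab_group_add) glel" where
  "gl_zero = ((\<lambda>_. 0), (\<lambda>_. 0))"

definition gl_add :: "('v::ab_group_add,'w::ab_group_add) glel \<Rightarrow> ('v,'w) glel \<Rightarrow> ('v,'w) glel" where
  "gl_add x z = ((\<lambda>u. fst x u + fst z u), (\<lambda>y. snd x y + snd z y))"

definition gl_smul :: "(complex \<Rightarrow> 'v \<Rightarrow> 'v) \<Rightarrow> (complex \<Rightarrow> 'w \<Rightarrow> 'w)
    \<Rightarrow> complex \<Rightarrow> ('v,'w) glel \<Rightarrow> ('v,'w) glel" where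
  "gl_smul sV sW c x = ((\<lambda>u. sV c (fst x u)), (\<lambda>y. sW c (snd x y)))"

definition gl_br :: "('v::ab_group_add,'w::ab_group_add) glel \<Rightarrow> ('v,'w) glel \<Rightarrow> ('v,'w) glel" where
  "gl_br x z = ((\<lambda>u. fst x (fst z u) - fst z (fst x u)), (\<lambda>y. snd x (snd z y) - snd z (snd x y)))"

definition gl_subspace :: "(complex \<Rightarrow> 'v::ab_group_add \<Rightarrow> 'v) \<Rightarrow> (complex \<Rightarrow> 'w::ab_group_add \<Rightarrow> 'w)
    \<Rightarrow> ('v,'w) glel set \<Rightarrow> bool" where
  "gl_subspace sV sW T \<longleftrightarrow> gl_zero \<in> T \<and> (\<forall>x\<in>T. \<forall>z\<in>T. gl_add x z \<in> T)
      \<and> (\<forall>c. \<forall>x\<in>T. gl_smul sV sW c x \<in> T)"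

definition gl_span :: "(complex \<Rightarrow> 'v::ab_group_add \<Rightarrow> 'v) \<Rightarrow> (complex \<Rightarrow> 'w::ab_group_add \<Rightarrow> 'w)
    \<Rightarrow> ('v,'w) glel set \<Rightarrow> ('v,'w) glel set" where
  "gl_span sV sW X = \<Inter>{T. gl_subspace sV sW T \<and> X \<subseteq> T}"

definition lie_closed :: "(complex \<Rightarrow> 'v::ab_group_add \<Rightarrow> 'v) \<Rightarrow> (complex \<Rightarrow> 'w::ab_group_add \<Rightarrow> 'w)
    \<Rightarrow> ('v,'w) glel set \<Rightarrow> bool" where
  "lie_closed sV sW T \<longleftrightarrow> gl_subspace sV sW T \<and> (\<forall>x\<in>T. \<forall>z\<in>T. gl_br x z \<in> T)"

definition gl_subalgebra ::
  "(complex \<Rightarrow> 'v::ab_group_add \<Rightarrow> 'v) \<Rightarrow> (complex \<Rightarrow> 'w::ab_group_add \<Rightarrow> 'w)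
    \<Rightarrow> ('v \<Rightarrow> 'w \<Rightarrow> complex) \<Rightarrow> ('v,'w) glel set \<Rightarrow> bool" where
  "gl_subalgebra sV sW p k \<longleftrightarrow> k \<subseteq> glVV sV sW p \<and> lie_closed sV sW k"

definition gen_subalg :: "(complex \<Rightarrow> 'v::ab_group_add \<Rightarrow> 'v) \<Rightarrow> (complex \<Rightarrow> 'w::ab_group_add \<Rightarrow> 'w)
    \<Rightarrow> ('v,'w) glel set \<Rightarrow> ('v,'w) glel set" where
  "gen_subalg sV sW X = \<Inter>{T. lie_closed sV sW T \<and> X \<subseteq> T}"

definition derived :: "(complex \<Rightarrow> 'v::ab_group_add \<Rightarrow> 'v) \<Rightarrow> (complex \<Rightarrow> 'w::ab_group_add \<Rightarrow> 'w)
    \<Rightarrow> ('v,'w) glel set \<Rightarrow> ('v,'w) glel set" where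
  "derived sV sW L = gl_span sV sW {gl_br x z | x z. x \<in> L \<and> z \<in> L}"

definition lie_solvable :: "(complex \<Rightarrow> 'v::ab_group_add \<Rightarrow> 'v) \<Rightarrow> (complex \<Rightarrow> 'w::ab_group_add \<Rightarrow> 'w)
    \<Rightarrow> ('v,'w) glel set \<Rightarrow> bool" where
  "lie_solvable sV sW L \<longleftrightarrow> (\<exists>n. (derived sV sW ^^ n) L \<subseteq> {gl_zero})"

definition locally_solvable :: "(complex \<Rightarrow> 'v::ab_group_add \<Rightarrow> 'v) \<Rightarrow> (complex \<Rightarrow> 'w::ab_group_add \<Rightarrow> 'w)
    \<Rightarrow> ('v,'w) glel set \<Rightarrow> bool" where
  "locally_solvable sV sW L \<longleftrightarrow>
     (\<forall>X. finite X \<and> X \<subseteq> L \<longrightarrow> lie_solvable sV sW (gen_subalg sV sW X))"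

definition lie_ideal :: "(complex \<Rightarrow> 'v::ab_group_add \<Rightarrow> 'v) \<Rightarrow> (complex \<Rightarrow> 'w::ab_group_add \<Rightarrow> 'w)
    \<Rightarrow> ('v,'w) glel set \<Rightarrow> ('v,'w) glel set \<Rightarrow> bool" where
  "lie_ideal sV sW k I \<longleftrightarrow> I \<subseteq> k \<and> gl_subspace sV sW I \<and> (\<forall>x\<in>k. \<forall>z\<in>I. gl_br x z \<in> I)"

definition ls_radical :: "(complex \<Rightarrow> 'v::ab_group_add \<Rightarrow> 'v) \<Rightarrow> (complex \<Rightarrow> 'w::ab_group_add \<Rightarrow> 'w)
    \<Rightarrow> ('v,'w) glel set \<Rightarrow> ('v,'w) glel set" where
  "ls_radical sV sW k = (THE R. lie_ideal sV sW k R \<and> locally_solvable sV sW R \<and>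
      (\<forall>I. lie_ideal sV sW k I \<and> locally_solvable sV sW I \<longrightarrow> I \<subseteq> R))"

definition lin_nilrad :: "(complex \<Rightarrow> 'v::ab_group_add \<Rightarrow> 'v) \<Rightarrow> (complex \<Rightarrow> 'w::ab_group_add \<Rightarrow> 'w)
    \<Rightarrow> ('v,'w) glel set \<Rightarrow> ('v,'w) glel set" where
  "lin_nilrad sV sW k = {x \<in> ls_radical sV sW k. \<exists>n. (fst x ^^ n) = (\<lambda>_. 0)}"

definition perpV :: "('v \<Rightarrow> 'w::zero \<Rightarrow> complex) \<Rightarrow> 'v set \<Rightarrow> 'w set" where
  "perpV p F = {y. \<forall>u\<in>F. p u y = 0}"

definition perpW :: "('v \<Rightarrow> 'w \<Rightarrow> complex) \<Rightarrow> 'w set \<Rightarrow> 'v set" where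
  "perpW p G = {u. \<forall>y\<in>G. p u y = 0}"

definition closureV :: "('v \<Rightarrow> 'w::zero \<Rightarrow> complex) \<Rightarrow> 'v set \<Rightarrow> 'v set" where
  "closureV p F = perpW p (perpV p F)"

definition closureW :: "('v \<Rightarrow> 'w::zero \<Rightarrow> complex) \<Rightarrow> 'w set \<Rightarrow> 'w set" where
  "closureW p G = perpV p (perpW p G)"

definition closedV :: "('v \<Rightarrow> 'w::zero \<Rightarrow> complex) \<Rightarrow> 'v set \<Rightarrow> bool" where
  "closedV p F \<longleftrightarrow> F = closureV p F"

definition closedW :: "('v \<Rightarrow> 'w::zero \<Rightarrow> complex) \<Rightarrow> 'w set \<Rightarrow> bool" where
  "closedW p G \<longleftrightarrow> G = closureW p G"

definition flag_pairs :: "'a set set \<Rightarrow> ('a set \<times> 'a set) set" where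
  "flag_pairs \<FF> = {(A,B). A \<in> \<FF> \<and> B \<in> \<FF> \<and> A \<subset> B \<and> \<not> (\<exists>H\<in>\<FF>. A \<subset> H \<and> H \<subset> B)}"

definition gen_flag :: "(complex \<Rightarrow> 'a::ab_group_add \<Rightarrow> 'a) \<Rightarrow> 'a set set \<Rightarrow> bool" where
  "gen_flag s \<FF> \<longleftrightarrow>
     (\<forall>F\<in>\<FF>. module.subspace s F) \<and>
     (\<forall>A\<in>\<FF>. \<forall>B\<in>\<FF>. A \<subseteq> B \<or> B \<subseteq> A) \<and>
     (\<forall>F\<in>\<FF>. \<exists>(A,B)\<in>flag_pairs \<FF>. F = A \<or> F = B) \<and>
     (\<forall>v. v \<noteq> 0 \<longrightarrow> (\<exists>(A,B)\<in>flag_pairs \<FF>. v \<in> B \<and> v \<notin> A))"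

definition semiclosedV :: "('v \<Rightarrow> 'w::zero \<Rightarrow> complex) \<Rightarrow> 'v set set \<Rightarrow> bool" where
  "semiclosedV p \<FF> \<longleftrightarrow> (\<forall>(A,B)\<in>flag_pairs \<FF>. closureV p A = A \<or> closureV p A = B)"

definition semiclosedW :: "('v \<Rightarrow> 'w::zero \<Rightarrow> complex) \<Rightarrow> 'w set set \<Rightarrow> bool" where
  "semiclosedW p \<GG> \<longleftrightarrow> (\<forall>(A,B)\<in>flag_pairs \<GG>. closureW p A = A \<or> closureW p A = B)"

definition StV :: "(complex \<Rightarrow> 'v::ab_group_add \<Rightarrow> 'v) \<Rightarrow> (complex \<Rightarrow> 'w::ab_group_add \<Rightarrow> 'w)
    \<Rightarrow> ('v \<Rightarrow> 'w \<Rightarrow> complex) \<Rightarrow> 'v set set \<Rightarrow> ('v,'w) glel set" where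
  "StV sV sW p \<FF> = {x \<in> glVV sV sW p. \<forall>F\<in>\<FF>. fst x ` F \<subseteq> F}"

definition StW :: "(complex \<Rightarrow> 'v::ab_group_add \<Rightarrow> 'v) \<Rightarrow> (complex \<Rightarrow> 'w::ab_group_add \<Rightarrow> 'w)
    \<Rightarrow> ('v \<Rightarrow> 'w \<Rightarrow> complex) \<Rightarrow> 'w set set \<Rightarrow> ('v,'w) glel set" where
  "StW sV sW p \<GG> = {x \<in> glVV sV sW p. \<forall>G\<in>\<GG>. snd x ` G \<subseteq> G}"

definition taut_couple :: "(complex \<Rightarrow> 'v::ab_group_add \<Rightarrow> 'v) \<Rightarrow> (complex \<Rightarrow> 'w::ab_group_add \<Rightarrow> 'w)
    \<Rightarrow> ('v \<Rightarrow> 'w \<Rightarrow> complex) \<Rightarrow> 'v set set \<Rightarrow> 'w set set \<Rightarrow> bool" where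
  "taut_couple sV sW p \<FF> \<GG> \<longleftrightarrow>
     gen_flag sV \<FF> \<and> gen_flag sW \<GG> \<and> semiclosedV p \<FF> \<and> semiclosedW p \<GG> \<and>
     (\<forall>x\<in>StW sV sW p \<GG>. \<forall>F\<in>\<FF>. snd x ` perpV p F \<subseteq> perpV p F) \<and>
     (\<forall>x\<in>StV sV sW p \<FF>. \<forall>G\<in>\<GG>. fst x ` perpW p G \<subseteq> perpW p G)"

text \<open>The index set C: pairs alpha of F with F'_alpha closed, matched with the pairs beta
of G with G'_beta closed via G'_beta = (F''_alpha)^perp.\<close>
definition taut_C :: "('v \<Rightarrow> 'w::zero \<Rightarrow> complex) \<Rightarrow> 'v set set \<Rightarrow> 'w set set
    \<Rightarrow> (('v set \<times> 'v set) \<times> ('w set \<times> 'w set)) set" where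
  "taut_C p \<FF> \<GG> = {((F1,F2),(G1,G2)). (F1,F2) \<in> flag_pairs \<FF> \<and> (G1,G2) \<in> flag_pairs \<GG> \<and>
      closedV p F1 \<and> closedW p G1 \<and> G1 = perpV p F2}"

text \<open>The quotient B/A of k-stable subspaces A \<subset> B is an irreducible k-module
(submodules of B/A correspond to k-stable subspaces between A and B).\<close>
definition irred_quot :: "(complex \<Rightarrow> 'a::ab_group_add \<Rightarrow> 'a) \<Rightarrow> ('x \<Rightarrow> 'a \<Rightarrow> 'a) \<Rightarrow> 'x set
    \<Rightarrow> 'a set \<Rightarrow> 'a set \<Rightarrow> bool" where
  "irred_quot s act k A B \<longleftrightarrow> module.subspace s A \<and> module.subspace s B \<and> A \<subset> B \<and>
     (\<forall>x\<in>k. act x ` A \<subseteq> A \<and> act x ` B \<subseteq> B) \<and>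
     (\<forall>M. module.subspace s M \<and> A \<subseteq> M \<and> M \<subseteq> B \<and> (\<forall>x\<in>k. act x ` M \<subseteq> M)
          \<longrightarrow> M = A \<or> M = B)"

definition countable_dim :: "(complex \<Rightarrow> 'a::ab_group_add \<Rightarrow> 'a) \<Rightarrow> bool" where
  "countable_dim s \<longleftrightarrow> (\<exists>B. countable B \<and> module.independent s B \<and> module.span s B = UNIV)"

definition nondeg_pairing :: "(complex \<Rightarrow> 'v::ab_group_add \<Rightarrow> 'v) \<Rightarrow> (complex \<Rightarrow> 'w::ab_group_add \<Rightarrow> 'w)
    \<Rightarrow> ('v \<Rightarrow> 'w \<Rightarrow> complex) \<Rightarrow> bool" where
  "nondeg_pairing sV sW p \<longleftrightarrow>
     (\<forall>u u' y. p (u + u') y = p u y + p u' y) \<and> (\<forall>c u y. p (sV c u) y = c * p u y) \<and>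
     (\<forall>u y y'. p u (y + y') = p u y + p u y') \<and> (\<forall>c u y. p u (sW c y) = c * p u y) \<and>
     (\<forall>u. (\<forall>y. p u y = 0) \<longrightarrow> u = 0) \<and> (\<forall>y. (\<forall>u. p u y = 0) \<longrightarrow> y = 0)"

end

theory Submission
  imports Defs
    "HOL-Computational_Algebra.Fundamental_Theorem_Algebra"
    "HOL-Library.Function_Algebras" "HOL-Library.Product_Plus"
begin

text \<open>
  Elements of \<open>gl(V, V\<^sub>*)\<close> have the same image on a subspace as on its closure. Hence if \<open>Y \<subset> Z\<close>
  are neighbours in a maximal chain of closed \<open>k\<close>-submodules, every submodule strictly between
  \<open>Y\<close> and \<open>Z\<close> contains \<open>k Z\<close>, so there is a least submodule strictly above \<open>Y\<close>. Adjoining these least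
  submodules to the chain gives a semiclosed generalized flag whose pairs with closed predecessor are
  irreducible; \<open>\<GG>\<close> arises in the same way from the orthogonal complements of the chain, and the
  stability conditions of a taut couple hold because stabilizing either flag means stabilizing the
  underlying chain of closed subspaces.

  For any subalgebra with such a flag, the linear nilradical consists of the elements that map
  \<open>F''\<close> into \<open>F'\<close> for every pair, and this description is compatible with intersections. Elements of
  this kind form a locally solvable ideal of nilpotent operators. Conversely, let \<open>x\<close> be a nilpotent
  element of the locally solvable radical with \<open>x q \<notin> F'\<close> for some \<open>q \<in> F''\<close>. By irreducibility finitely many
  elements of \<open>k\<close> generate \<open>q\<close> from \<open>x q\<close> modulo \<open>F'\<close>; together with \<open>x\<close> they generate a
  finite-dimensional Lie algebra, in which Lie's theorem forces \<open>x\<close> to act by zero on every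
  finite-dimensional irreducible module, a contradiction.
\<close>

section \<open>Solvable Lie algebras of operators on finite-dimensional spaces\<close>

text \<open>Flags built from arbitrary submodules of both spaces would not be linked. Closed
  submodules are: orthogonal complements give an inclusion-reversing bijection between those of
  \<open>V\<close> and those of \<open>V_*\<close>, so one chain governs both flags. The price is
  that a dense proper submodule can sit between neighbours of the chain; least submodules are
  adjoined for this reason, and the flags become only semiclosed. Where a predecessor is not closed,
  \<open>F''\<close> is the closure of \<open>F'\<close>, and every stabilizing element maps
  \<open>F''\<close> into \<open>F'\<close> anyway. Irreducibility under \<open>k\<close> passes to
  the larger stabilizer, so one description by the flag covers both nilradicals.

  The quotients \<open>F''/F'\<close> may be infinite-dimensional, hence the detour through
  finite-dimensional modules of finitely generated subalgebras. Lie's theorem takes the form that a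
  solvable ideal acts by scalars on an irreducible module. In place of the trace of a commutator, a
  growth argument shows that a commutator \<open>[y, z]\<close> commuting with \<open>y\<close> is
  singular.\<close>

lemmas lin_add = module_hom.add[OF module_hom_linearI]
  and lin_scale = module_hom.scale[OF module_hom_linearI]
  and lin_diff = module_hom.diff[OF module_hom_linearI]
  and lin_zero = module_hom.zero[OF module_hom_linearI]
  and lin_sum = module_hom.sum[OF module_hom_linearI]

section \<open>Subspaces of extremal dimension\<close>

context vector_space
begin

text \<open>\<open>dim\<close> is the cardinality of a basis, hence 0 for an infinite one; the
  finite \<open>E\<close> makes the comparison meaningful. A basis of \<open>A\<close> with one
  vector outside \<open>A\<close> added is still independent.\<close>

lemma dim_strict_mono:
  assumes "subspace A" "A \<subset> B" "B \<subseteq> span E" "finite E"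
  shows "dim A < dim B"
proof -
  obtain S where S: "S \<subseteq> A" "independent S" "A \<subseteq> span S" "card S = dim A"
    by (rule basis_exists[of A])
  obtain T where T: "T \<subseteq> B" "independent T" "B \<subseteq> span T" "card T = dim B"
    by (rule basis_exists[of B])
  have "T \<subseteq> span E" using T(1) assms(3) by (rule order_trans)
  from independent_span_bound[OF \<open>finite E\<close> T(2) this] have finT: "finite T" ..
  obtain v where v: "v \<in> B" "v \<notin> A" using assms(2) by blast
  have "v \<notin> span S" using v span_minimal[OF S(1) assms(1)] by blast
  hence ind: "independent (insert v S)" using S(2) by (rule independent_insertI)
  have "insert v S \<subseteq> span T" using v S(1) assms(2) T(3) by blast
  from independent_span_bound[OF finT ind this]
  have "finite (insert v S)" "card (insert v S) \<le> card T" by simp_all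
  moreover have "v \<notin> S" using v S(1) by blast
  ultimately show ?thesis using S(4) T(4) by simp
qed

lemma minimal_subspace_exists:
  assumes "Q P0" "\<And>P. Q P \<Longrightarrow> subspace P \<and> P \<subseteq> span E" "finite E"
  shows "\<exists>P. Q P \<and> (\<forall>P'. Q P' \<longrightarrow> P' \<subseteq> P \<longrightarrow> P' = P)"
proof -
  obtain P where P: "Q P" "\<And>P'. Q P' \<Longrightarrow> dim P \<le> dim P'"
    using ex_has_least_nat[of Q P0 dim] assms(1) by blast
  show ?thesis
  proof (intro exI[of _ P] conjI allI impI P(1))
    fix P' assume P': "Q P'" "P' \<subseteq> P"
    show "P' = P"
      using dim_strict_mono[of P' P E] assms(2)[OF P'(1)] assms(2)[OF P(1)] P(2)[OF P'(1)] P'(2)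
        assms(3) by (metis leD psubsetI)
  qed
qed

lemma maximal_subspace_exists:
  assumes "Q P0" "\<And>P. Q P \<Longrightarrow> subspace P \<and> P \<subseteq> span E" "finite E"
  shows "\<exists>P. Q P \<and> (\<forall>P'. Q P' \<longrightarrow> P \<subseteq> P' \<longrightarrow> P' = P)"
proof -
  have "\<forall>P. Q P \<longrightarrow> dim P < Suc (card E)"
    using assms dim_le_card by (simp add: less_Suc_eq_le)
  then obtain P where P: "Q P" "\<And>P'. Q P' \<Longrightarrow> dim P' \<le> dim P"
    using ex_has_greatest_nat[of Q P0 dim "Suc (card E)"] assms(1) by (metis less_imp_le)
  show ?thesis
  proof (intro exI[of _ P] conjI allI impI P(1))
    fix P' assume P': "Q P'" "P \<subseteq> P'"
    show "P' = P"
      using dim_strict_mono[of P P' E] assms(2)[OF P'(1)] assms(2)[OF P(1)] P(2)[OF P'(1)] P'(2)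
        assms(3) by (metis leD psubsetI)
  qed
qed

lemma linear_funpow: "Vector_Spaces.linear scale scale f \<Longrightarrow> Vector_Spaces.linear scale scale (f ^^ n)"
proof (induction n)
  case 0 show ?case using linear_id by (simp add: id_def)
next
  case (Suc n)
  show ?case unfolding funpow.simps by (rule Vector_Spaces.linear_compose[OF Suc.IH[OF Suc.prems] Suc.prems])
qed

lemma linear_minus_scale:
  assumes "Vector_Spaces.linear scale scale f"
  shows "Vector_Spaces.linear scale scale (\<lambda>v. f v - c *s v)"
  using assms unfolding Vector_Spaces.linear_iff
  by (simp add: scale_right_distrib scale_right_diff_distrib scale_left_commute)

end

section \<open>Eigenvectors from annihilating polynomials\<close>

definition poly_act :: "('a::comm_ring_1 \<Rightarrow> 'b::ab_group_add \<Rightarrow> 'b) \<Rightarrow> ('b \<Rightarrow> 'b) \<Rightarrow> 'a poly \<Rightarrow> 'b \<Rightarrow> 'b" where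
  "poly_act s f q v = (\<Sum>i\<le>degree q. s (coeff q i) ((f ^^ i) v))"

locale complex_space = vector_space scale
  for scale :: "complex \<Rightarrow> 'b::ab_group_add \<Rightarrow> 'b" (infixr \<open>*s\<close> 75)
begin

lemma poly_act_extend:
  assumes "degree q \<le> n"
  shows "poly_act scale f q v = (\<Sum>i\<le>n. coeff q i *s (f ^^ i) v)"
  unfolding poly_act_def using assms
  by (intro sum.mono_neutral_left) (auto simp: coeff_eq_0 not_le)

text \<open>Links roots to eigenvalues: if \<open>[:-c, 1:] * r\<close> annihilates \<open>v\<close>
  and \<open>r\<close> does not, then \<open>poly_act scale f r v\<close> is an eigenvector for
  \<open>c\<close>.\<close>

lemma poly_act_linear_factor:
  assumes "Vector_Spaces.linear scale scale f"
  shows "poly_act scale f ([:-c, 1:] * r) v = f (poly_act scale f r v) - c *s poly_act scale f r v"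
proof -
  let ?n = "degree r"
  have d: "degree ([:-c, 1:] * r) \<le> Suc ?n"
    using degree_mult_le[of "[:-c, 1:]" r] by simp
  have eq: "[:-c, 1:] * r = pCons 0 r - smult c r" by simp
  have "poly_act scale f ([:-c, 1:] * r) v
      = (\<Sum>i\<le>Suc ?n. coeff ([:-c, 1:] * r) i *s (f ^^ i) v)"
    by (rule poly_act_extend[OF d])
  also have "\<dots> = (\<Sum>i\<le>Suc ?n. coeff (pCons 0 r) i *s (f ^^ i) v)
       - (\<Sum>i\<le>Suc ?n. c *s (coeff r i *s (f ^^ i) v))"
    unfolding eq by (simp only: coeff_diff coeff_smult scale_left_diff_distrib sum_subtractf scale_scale)
  also have "(\<Sum>i\<le>Suc ?n. coeff (pCons 0 r) i *s (f ^^ i) v) = (\<Sum>i\<le>?n. coeff r i *s f ((f ^^ i) v))"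
    by (subst sum.atMost_Suc_shift) simp
  also have "\<dots> = f (poly_act scale f r v)"
    unfolding poly_act_def by (simp add: lin_sum[OF assms] lin_scale[OF assms])
  also have "(\<Sum>i\<le>Suc ?n. c *s (coeff r i *s (f ^^ i) v)) = c *s poly_act scale f r v"
    using poly_act_extend[of r "Suc ?n" f v] by (simp add: scale_sum_right scale_right_distrib)
  finally show ?thesis .
qed

lemma funpow_stable: "f ` M \<subseteq> M \<Longrightarrow> v \<in> M \<Longrightarrow> (f ^^ i) v \<in> M"
  by (induction i) auto

text \<open>Two equal iterates \<open>i < j\<close> give the polynomial X^j - X^i. Pairwise distinct
  iterates give \<open>Suc (card E)\<close> vectors in the span of \<open>E\<close>, and the
  coefficients of a dependency between them form the polynomial.\<close>

lemma annihilating_poly_exists: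
  assumes "subspace M" "f ` M \<subseteq> M" "M \<subseteq> span E" "finite E" "v \<in> M"
  shows "\<exists>q. q \<noteq> 0 \<and> poly_act scale f q v = 0"
proof (cases "inj (\<lambda>i. (f ^^ i) v)")
  case False
  then obtain i j where ij: "i < j" "(f ^^ i) v = (f ^^ j) v"
    by (auto simp: inj_def) (metis linorder_neqE_nat)
  let ?q = "monom 1 j - monom 1 i :: complex poly"
  have "coeff ?q j = 1" using ij by simp
  hence q0: "?q \<noteq> 0" by (metis coeff_0 zero_neq_one)
  have "degree ?q \<le> j"
    using ij(1) by (intro degree_diff_le) (simp_all add: degree_monom_eq)
  hence "poly_act scale f ?q v = (\<Sum>k\<le>j. coeff ?q k *s (f ^^ k) v)" by (rule poly_act_extend)
  also have "\<dots> = (\<Sum>k\<le>j. if k = j then (f ^^ k) v else 0) - (\<Sum>k\<le>j. if k = i then (f ^^ k) v else 0)"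
    unfolding sum_subtractf[symmetric] by (intro sum.cong) (simp_all add: scale_left_diff_distrib)
  also have "\<dots> = 0" using ij by simp
  finally have "poly_act scale f ?q v = 0" .
  with q0 show ?thesis by blast
next
  case True
  let ?n = "card E"
  let ?S = "(\<lambda>i. (f ^^ i) v) ` {..?n}"
  have inj: "inj_on (\<lambda>i. (f ^^ i) v) {..?n}" using True by (rule inj_on_subset) simp
  have "?S \<subseteq> span E" using funpow_stable[OF assms(2,5)] assms(3) by auto
  moreover have "card ?S = Suc ?n" using inj by (simp add: card_image)
  ultimately have "\<not> independent ?S" using independent_span_bound[OF \<open>finite E\<close>, of ?S] by linarith
  hence "dependent ?S" by simp
  then obtain u w where u: "(\<Sum>w\<in>?S. u w *s w) = 0" "w \<in> ?S" "u w \<noteq> 0"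
    unfolding dependent_finite[OF finite_imageI[OF finite_atMost]] by (elim exE conjE bexE)
  let ?q = "\<Sum>i\<le>?n. monom (u ((f ^^ i) v)) i"
  have c: "coeff ?q i = (if i \<le> ?n then u ((f ^^ i) v) else 0)" for i
    by (simp add: coeff_sum)
  have "degree ?q \<le> ?n" by (rule degree_le) (simp add: c)
  hence "poly_act scale f ?q v = (\<Sum>i\<le>?n. coeff ?q i *s (f ^^ i) v)" by (rule poly_act_extend)
  also have "\<dots> = (\<Sum>w\<in>?S. u w *s w)" by (subst sum.reindex[OF inj]) (simp add: c)
  finally have "poly_act scale f ?q v = 0" using u by simp
  moreover obtain i where "i \<le> ?n" "w = (f ^^ i) v" using u(2) by (elim imageE) simp
  hence "coeff ?q i \<noteq> 0" using u(3) by (simp only: c if_True not_False_eq_True)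
  hence "?q \<noteq> 0" by (metis coeff_0)
  ultimately show ?thesis by blast
qed

text \<open>An annihilator \<open>q\<close> of \<open>v0\<close> of least degree is not constant, so
  it has a root \<open>c\<close>. By minimality the cofactor \<open>r\<close> does not annihilate
  \<open>v0\<close>, and \<open>r\<close> applied to \<open>v0\<close> is the eigenvector.\<close>

lemma eigenvector_exists:
  assumes f: "Vector_Spaces.linear scale scale f" and M: "subspace M" "f ` M \<subseteq> M" "M \<subseteq> span E" "finite E" "M \<noteq> {0}"
  obtains c v where "v \<in> M" "v \<noteq> 0" "f v = c *s v"
proof -
  obtain v0 where v0: "v0 \<in> M" "v0 \<noteq> 0" using M subspace_0 by blast
  define Q where "Q = (\<lambda>q. q \<noteq> 0 \<and> poly_act scale f q v0 = 0)"
  have "\<exists>q. Q q" unfolding Q_def by (rule annihilating_poly_exists[OF M(1-4) v0(1)])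
  then obtain q where Qq: "Q q" "\<And>r. Q r \<Longrightarrow> degree q \<le> degree r"
    using ex_has_least_nat[of Q _ degree] by blast
  hence q: "q \<noteq> 0" "poly_act scale f q v0 = 0" by (simp_all add: Q_def)
  have "degree q \<noteq> 0"
  proof
    assume "degree q = 0"
    hence "coeff q 0 \<noteq> 0" "poly_act scale f q v0 = coeff q 0 *s v0"
      using q(1) by (auto simp: poly_act_def dest: leading_coeff_neq_0)
    thus False using q(2) v0 by simp
  qed
  hence "\<not> constant (poly q)" by (simp add: constant_degree)
  then obtain c where "poly q c = 0" using fundamental_theorem_of_algebra by blast
  then obtain r where r: "q = [:-c, 1:] * r" using poly_eq_0_iff_dvd dvdE by metis
  have r0: "r \<noteq> 0" using q(1) r by auto
  have "degree q = degree [:-c, 1:] + degree r"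
    unfolding r using r0 by (intro degree_mult_eq) auto
  hence w: "poly_act scale f r v0 \<noteq> 0" using Qq(2)[of r] r0 by (auto simp: Q_def)
  have "poly_act scale f r v0 \<in> M"
    unfolding poly_act_def using M(1) funpow_stable[OF M(2) v0(1)]
    by (intro subspace_sum) (auto intro: subspace_scale)
  moreover have "f (poly_act scale f r v0) = c *s poly_act scale f r v0"
    using poly_act_linear_factor[OF f, of c r v0] q(2) r by simp
  ultimately show thesis using that w by blast
qed

text \<open>The usual formula for the commutator of a power, valid because the commutator
  \<open>c\<close> of \<open>\<nu>\<close> and \<open>z\<close> commutes with \<open>\<nu>\<close>.
  It is evaluated at vectors of \<open>B\<close>, where alone the commutation relations are
  available.\<close>

lemma commutator_power:
  assumes nu: "Vector_Spaces.linear scale scale \<nu>" and B: "\<nu> ` B \<subseteq> B"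
    and c: "\<And>u. u \<in> B \<Longrightarrow> \<nu> (z u) = z (\<nu> u) + c u" "\<And>u. u \<in> B \<Longrightarrow> \<nu> (c u) = c (\<nu> u)"
    and v: "v \<in> B"
  shows "(\<nu> ^^ Suc n) (z v) = z ((\<nu> ^^ Suc n) v) + of_nat (Suc n) *s c ((\<nu> ^^ n) v)"
proof (induction n)
  case 0 show ?case using c(1)[OF v] by simp
next
  case (Suc n)
  have m: "(\<nu> ^^ k) v \<in> B" for k by (rule funpow_stable[OF B v])
  have "(\<nu> ^^ Suc (Suc n)) (z v) = \<nu> ((\<nu> ^^ Suc n) (z v))" by simp
  also have "\<dots> = \<nu> (z ((\<nu> ^^ Suc n) v)) + of_nat (Suc n) *s \<nu> (c ((\<nu> ^^ n) v))"
    unfolding Suc.IH by (simp add: lin_add[OF nu] lin_scale[OF nu] del: of_nat_Suc)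
  also have "\<nu> (z ((\<nu> ^^ Suc n) v)) = z ((\<nu> ^^ Suc (Suc n)) v) + c ((\<nu> ^^ Suc n) v)"
    using c(1)[OF m, of "Suc n"] by simp
  also have "\<nu> (c ((\<nu> ^^ n) v)) = c ((\<nu> ^^ Suc n) v)" using c(2)[OF m, of n] by simp
  finally show ?case
    by (simp only: of_nat_Suc[of "Suc n"] scale_left_distrib scale_one add.assoc)
qed

text \<open>If \<open>c\<close> were injective, \<open>z\<close> would map vectors of height \<open>n\<close> for the nilpotent
  part \<open>\<nu>\<close> of \<open>y\<close> to vectors of height \<open>n + 1\<close>, so all heights would occur.\<close>

lemma commuting_commutator_singular:
  assumes y: "Vector_Spaces.linear scale scale y"
    and B: "subspace B" "B \<noteq> {0}" "B \<subseteq> span E" "finite E" "y ` B \<subseteq> B" "z ` B \<subseteq> B" "c ` B \<subseteq> B"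
    and z: "Vector_Spaces.linear scale scale z"
    and c: "Vector_Spaces.linear scale scale c" "\<And>u. u \<in> B \<Longrightarrow> c u = y (z u) - z (y u)" "\<And>u. u \<in> B \<Longrightarrow> y (c u) = c (y u)"
  shows "\<exists>w\<in>B. w \<noteq> 0 \<and> c w = 0"
proof (rule ccontr)
  assume "\<not> ?thesis"
  hence inj: "c w \<noteq> 0" if "w \<in> B" "w \<noteq> 0" for w using that by blast
  obtain a v0 where v0: "v0 \<in> B" "v0 \<noteq> 0" "y v0 = a *s v0"
    using eigenvector_exists[OF y B(1,5,3,4,2)] by blast
  \<comment> \<open>Subtracting the scalar \<open>a\<close> leaves both commutation relations
    unchanged and gives \<open>v0\<close> height 1, which starts the induction.\<close>
  define \<nu> where "\<nu> = (\<lambda>v. y v - a *s v)"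
  have nu: "Vector_Spaces.linear scale scale \<nu>" unfolding \<nu>_def by (rule linear_minus_scale[OF y])
  have nuB: "\<nu> ` B \<subseteq> B" unfolding \<nu>_def using B by (auto intro!: subspace_diff subspace_scale)
  have c1: "\<nu> (z u) = z (\<nu> u) + c u" if "u \<in> B" for u
    using c(2)[OF that] by (simp add: \<nu>_def lin_diff[OF z] lin_scale[OF z])
  have c2: "\<nu> (c u) = c (\<nu> u)" if "u \<in> B" for u
    using c(3)[OF that] by (simp add: \<nu>_def lin_diff[OF c(1)] lin_scale[OF c(1)])
  have cp: "(\<nu> ^^ Suc n) (z v) = z ((\<nu> ^^ Suc n) v) + of_nat (Suc n) *s c ((\<nu> ^^ n) v)"
    if "v \<in> B" for n v
    using commutator_power[of \<nu> B z c v n] nu nuB c1 c2 that by blast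
  have ex: "\<exists>v\<in>B. (\<nu> ^^ n) v \<noteq> 0 \<and> (\<nu> ^^ Suc n) v = 0" for n
  proof (induction n)
    case 0 show ?case using v0 by (intro bexI[of _ v0]) (auto simp: \<nu>_def)
  next
    case (Suc n)
    then obtain v where v: "v \<in> B" "(\<nu> ^^ n) v \<noteq> 0" "(\<nu> ^^ Suc n) v = 0" by blast
    have m: "(\<nu> ^^ k) v \<in> B" for k by (rule funpow_stable[OF nuB v(1)])
    have "(\<nu> ^^ Suc n) (z v) = of_nat (Suc n) *s c ((\<nu> ^^ n) v)"
      using cp[OF v(1), of n] v(3) lin_zero[OF z] by simp
    \<comment> \<open>Characteristic 0 enters here: the factor \<open>Suc n\<close> is
      nonzero.\<close>
    hence "(\<nu> ^^ Suc n) (z v) \<noteq> 0" using inj[OF m v(2)] by (simp del: of_nat_Suc)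
    moreover have "(\<nu> ^^ Suc (Suc n)) v = 0" using v(3) lin_zero[OF nu] by simp
    hence "(\<nu> ^^ Suc (Suc n)) (z v) = 0"
      using cp[OF v(1), of "Suc n"] v(3) lin_zero[OF z] lin_zero[OF c(1)] by simp
    ultimately show ?case using B(6) v(1) by blast
  qed
  \<comment> \<open>The kernels of the powers of \<open>\<nu>\<close> would grow strictly forever
    inside the finite-dimensional \<open>span E\<close>.\<close>
  define K where "K = (\<lambda>n. {v \<in> B. (\<nu> ^^ n) v = 0})"
  have sub: "subspace (K n)" for n
    unfolding K_def using B(1) linear_funpow[OF nu, of n, THEN lin_add]
      linear_funpow[OF nu, of n, THEN lin_scale] linear_funpow[OF nu, of n, THEN lin_zero]
    by (auto simp: subspace_def)
  have Kstrict: "K n \<subset> K (Suc n)" for n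
    using ex[of n] lin_zero[OF nu] by (auto simp: K_def)
  have KB: "K n \<subseteq> span E" for n using B(3) by (auto simp: K_def)
  have lt: "dim (K n) < dim (K (Suc n))" for n
    by (rule dim_strict_mono[OF sub Kstrict KB B(4)])
  have "n \<le> dim (K n)" for n
  proof (induction n)
    case (Suc n) thus ?case using lt[of n] by simp
  qed simp
  moreover have "dim (K n) \<le> card E" for n using KB B(4) by (rule dim_le_card)
  ultimately have "Suc (card E) \<le> card E" using order_trans by blast
  thus False by simp
qed

end

section \<open>Lie's theorem on an irreducible finite-dimensional module\<close>

locale irreducible_action = complex_space scale
  for scale :: "complex \<Rightarrow> 'b::ab_group_add \<Rightarrow> 'b" (infixr \<open>*s\<close> 75) +
  fixes L :: "'x set" and br :: "'x \<Rightarrow> 'x \<Rightarrow> 'x" and act :: "'x \<Rightarrow> 'b \<Rightarrow> 'b"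
    and B :: "'b set" and E :: "'b set"
  assumes act_linear: "x \<in> L \<Longrightarrow> Vector_Spaces.linear scale scale (act x)"
    and act_br: "x \<in> L \<Longrightarrow> y \<in> L \<Longrightarrow> act (br x y) u = act x (act y u) - act y (act x u)"
    and br_closed: "x \<in> L \<Longrightarrow> y \<in> L \<Longrightarrow> br x y \<in> L"
    and act_stable: "x \<in> L \<Longrightarrow> act x ` B \<subseteq> B"
    and B_subspace: "subspace B" and B_nonzero: "B \<noteq> {0}"
    and B_fin: "B \<subseteq> span E" "finite E"
    and irreducible: "subspace M \<Longrightarrow> M \<subseteq> B \<Longrightarrow> (\<And>x. x \<in> L \<Longrightarrow> act x ` M \<subseteq> M) \<Longrightarrow> M = {0} \<or> M = B"
begin

lemma act_in: "x \<in> L \<Longrightarrow> u \<in> B \<Longrightarrow> act x u \<in> B"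
  using act_stable by blast

context
  fixes J
  assumes J: "J \<subseteq> L" and ideal: "\<And>x y. x \<in> L \<Longrightarrow> y \<in> J \<Longrightarrow> br y x \<in> J"
    and commutes: "\<And>x y u. x \<in> J \<Longrightarrow> y \<in> J \<Longrightarrow> u \<in> B \<Longrightarrow> act x (act y u) = act y (act x u)"
begin

text \<open>The vectors killed by some power of \<open>c\<close> form an \<open>L\<close>-submodule:
  \<open>br c z\<close> lies in \<open>J\<close>, so it commutes with \<open>c\<close>, and by
  \<open>commutator_power\<close> the action of \<open>z\<close> raises the required exponent by at
  most one. The submodule contains \<open>w\<close>, hence is all of \<open>B\<close>.\<close>

lemma singular_imp_locally_nilpotent:
  assumes c: "c \<in> J" and w: "w \<in> B" "w \<noteq> 0" "act c w = 0" and v: "v \<in> B"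
  shows "\<exists>n. (act c ^^ n) v = 0"
proof -
  define M where "M = {v \<in> B. \<exists>n. (act c ^^ n) v = 0}"
  have cL: "c \<in> L" using c J by blast
  have lin: "Vector_Spaces.linear scale scale (act c ^^ n)" for n by (rule linear_funpow[OF act_linear[OF cL]])
  have mono: "(act c ^^ (n + m)) u = 0" if "(act c ^^ n) u = 0" for n m u
    using that lin_zero[OF lin, of m] by (simp add: add.commute[of n] funpow_add)
  have "subspace M"
  proof (rule subspaceI)
    show "0 \<in> M" using subspace_0[OF B_subspace] lin_zero[OF lin] by (auto simp: M_def)
  next
    fix x y assume x: "x \<in> M" and y: "y \<in> M"
    then obtain n m where nm: "(act c ^^ n) x = 0" "(act c ^^ m) y = 0" by (auto simp: M_def)
    have "(act c ^^ (n + m)) (x + y) = 0"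
      using mono[OF nm(1), of m] mono[OF nm(2), of n] by (simp add: lin_add[OF lin] add.commute)
    thus "x + y \<in> M" using x y subspace_add[OF B_subspace] by (auto simp: M_def)
  next
    fix a x assume "x \<in> M"
    thus "a *s x \<in> M" using subspace_scale[OF B_subspace] by (auto simp: M_def lin_scale[OF lin])
  qed
  moreover have "act z ` M \<subseteq> M" if z: "z \<in> L" for z
  proof clarify
    fix u assume "u \<in> M"
    then obtain n where u: "u \<in> B" "(act c ^^ n) u = 0" by (auto simp: M_def)
    have d: "br c z \<in> J" using ideal z c by blast
    have "(act c ^^ Suc n) (act z u)
        = act z ((act c ^^ Suc n) u) + of_nat (Suc n) *s act (br c z) ((act c ^^ n) u)"
      by (rule commutator_power[of _ B]) (use cL z c d u act_stable J in
          \<open>auto simp: act_linear act_br commutes\<close>)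
    also have "\<dots> = 0"
      using u(2) lin_zero[OF act_linear[OF z]] lin_zero[OF act_linear[OF cL]]
        lin_zero[OF act_linear, of "br c z"] d J by (simp add: subset_iff)
    finally show "act z u \<in> M" using act_in[OF z u(1)] unfolding M_def by blast
  qed
  moreover have "M \<subseteq> B" by (auto simp: M_def)
  moreover have "w \<in> M" using w by (auto simp: M_def intro!: exI[of _ 1])
  ultimately have "M = B" using irreducible[of M] w(2) by blast
  thus ?thesis using v by (auto simp: M_def)
qed

text \<open>In a minimal nonzero \<open>J\<close>-stable subspace each nonzero eigenspace of an
  element of \<open>J\<close> is \<open>J\<close>-stable by commutativity, hence is the whole
  subspace. Any nonzero vector there is a common eigenvector.\<close>

lemma common_eigenvector:
  obtains w where "w \<in> B" "w \<noteq> 0" "\<And>y. y \<in> J \<Longrightarrow> \<exists>c. act y w = c *s w"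
proof -
  define Q where "Q = (\<lambda>M. subspace M \<and> M \<subseteq> B \<and> M \<noteq> {0} \<and> (\<forall>y\<in>J. act y ` M \<subseteq> M))"
  have "Q B" using B_subspace B_nonzero act_stable J unfolding Q_def by blast
  moreover have "subspace M \<and> M \<subseteq> span E" if "Q M" for M
    using that B_fin(1) by (auto simp: Q_def)
  ultimately have "\<exists>M. Q M \<and> (\<forall>M'. Q M' \<longrightarrow> M' \<subseteq> M \<longrightarrow> M' = M)"
    using B_fin(2) by (rule minimal_subspace_exists)
  then obtain M where QM: "Q M" and min: "\<And>M'. Q M' \<Longrightarrow> M' \<subseteq> M \<Longrightarrow> M' = M"
    by blast
  from QM have M: "subspace M" "M \<subseteq> B" "M \<noteq> {0}" "\<And>y. y \<in> J \<Longrightarrow> act y ` M \<subseteq> M"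
    by (simp_all add: Q_def)
  obtain w where w: "w \<in> M" "w \<noteq> 0" using subspace_0[OF M(1)] M(3) by blast
  have "\<exists>c. act y w = c *s w" if y: "y \<in> J" for y
  proof -
    have yl: "Vector_Spaces.linear scale scale (act y)" using y J act_linear by blast
    obtain c v where v: "v \<in> M" "v \<noteq> 0" "act y v = c *s v"
      by (rule eigenvector_exists[OF yl M(1) M(4)[OF y] order_trans[OF M(2) B_fin(1)] B_fin(2) M(3)])
    let ?M' = "{u \<in> M. act y u = c *s u}"
    have sub: "subspace ?M'"
      using M(1) by (auto simp: subspace_def lin_zero[OF yl] lin_add[OF yl] lin_scale[OF yl]
          scale_right_distrib scale_left_commute)
    have st: "act x ` ?M' \<subseteq> ?M'" if x: "x \<in> J" for x
    proof clarify
      fix u assume u: "u \<in> M" "act y u = c *s u"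
      have xL: "x \<in> L" using x J by blast
      have "act y (act x u) = act x (act y u)" using u(1) M(2) by (intro commutes y x) blast
      also have "\<dots> = c *s act x u" unfolding u(2) by (rule lin_scale[OF act_linear[OF xL]])
      finally show "act x u \<in> M \<and> act y (act x u) = c *s act x u" using M(4)[OF x] u(1) by blast
    qed
    have nz: "?M' \<noteq> {0}" using v by blast
    have "Q ?M'" unfolding Q_def by (intro conjI ballI sub st nz) (use M(2) in blast)
    hence "?M' = M" by (rule min) blast
    thus ?thesis using w(1) by blast
  qed
  thus thesis using that w M(2) by blast
qed

text \<open>The weight space of \<open>w\<close> is \<open>L\<close>-stable once
  \<open>\<mu>\<close> vanishes at \<open>br y z\<close>. That commutator lies in \<open>J\<close>
  and commutes with \<open>y\<close>, so it is singular by
  \<open>commuting_commutator_singular\<close>, hence locally nilpotent, and its eigenvalue at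
  \<open>w\<close> is 0. Irreducibility makes the weight space all of \<open>B\<close>.\<close>

lemma commuting_ideal_acts_by_scalars:
  "\<exists>\<mu>. \<forall>y\<in>J. \<forall>u\<in>B. act y u = \<mu> y *s u"
proof -
  obtain w where w: "w \<in> B" "w \<noteq> 0" "\<And>y. y \<in> J \<Longrightarrow> \<exists>c. act y w = c *s w"
    using common_eigenvector by blast
  then obtain \<mu> where mu: "\<And>y. y \<in> J \<Longrightarrow> act y w = \<mu> y *s w" by metis
  have mu0: "\<mu> (br y z) = 0" if y: "y \<in> J" and z: "z \<in> L" for y z
  proof -
    let ?c = "br y z"
    have yL: "y \<in> L" and cJ: "?c \<in> J" and cL: "?c \<in> L" using y z J ideal by auto
    have "\<exists>w\<in>B. w \<noteq> 0 \<and> act ?c w = 0"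
      by (rule commuting_commutator_singular[of "act y" B E "act z"])
        (use yL cL z cJ y B_subspace B_nonzero B_fin in
          \<open>simp_all add: act_linear act_stable act_br[symmetric] commutes\<close>)
    then obtain n where n: "(act ?c ^^ n) w = 0"
      using singular_imp_locally_nilpotent[OF cJ] w(1) by blast
    have "(act ?c ^^ n) w = (\<mu> ?c) ^ n *s w"
      by (induction n) (auto simp: lin_scale[OF act_linear[OF cL]] mu[OF cJ] mult.commute)
    thus ?thesis using n w(2) by simp
  qed
  let ?W = "{v \<in> B. \<forall>y\<in>J. act y v = \<mu> y *s v}"
  have al: "Vector_Spaces.linear scale scale (act y)" if "y \<in> J" for y using act_linear that J by blast
  have "subspace ?W"
    using B_subspace by (auto simp: subspace_def lin_zero[OF al] lin_add[OF al] lin_scale[OF al]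
        scale_right_distrib scale_left_commute)
  moreover have "act z ` ?W \<subseteq> ?W" if z: "z \<in> L" for z
  proof clarify
    fix v assume v: "v \<in> B" "\<forall>y\<in>J. act y v = \<mu> y *s v"
    have "act y (act z v) = \<mu> y *s act z v" if y: "y \<in> J" for y
    proof -
      have yL: "y \<in> L" and cJ: "br y z \<in> J" using y z J ideal by auto
      have "act y (act z v) = act z (act y v) + act (br y z) v" using act_br[OF yL z] by simp
      thus ?thesis using v(2) y cJ mu0[OF y z] by (simp add: lin_scale[OF act_linear[OF z]])
    qed
    thus "act z v \<in> B \<and> (\<forall>y\<in>J. act y (act z v) = \<mu> y *s act z v)" using act_in[OF z v(1)] by blast
  qed
  moreover have "w \<in> ?W" using w mu by blast
  ultimately have "?W = B" using irreducible[of ?W] w(2) by blast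
  thus ?thesis by blast
qed

end

text \<open>A scalar commutes with everything, so \<open>commuting_commutator_singular\<close>
  applies to it, and a scalar that kills a nonzero vector is 0.\<close>

lemma scalar_commutator_zero:
  assumes "a \<in> L" "b \<in> L" "\<And>u. u \<in> B \<Longrightarrow> act (br a b) u = t *s u" "u \<in> B"
  shows "act (br a b) u = 0"
proof -
  have L: "br a b \<in> L" using assms br_closed by blast
  have st: "act (br a b) ` B \<subseteq> B" by (rule act_stable[OF L])
  have "\<exists>w\<in>B. w \<noteq> 0 \<and> act (br a b) w = 0"
    by (rule commuting_commutator_singular[of "act a" B E "act b"])
      (use st assms L B_subspace B_nonzero B_fin in
        \<open>simp_all del: image_subset_iff add: act_linear act_stable act_br[symmetric] act_in lin_scale[OF act_linear] cong: image_cong_simp\<close>)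
  hence "t = 0" using assms(3) by fastforce
  thus ?thesis using assms by simp
qed

end

section \<open>Flags from maximal chains of closed submodules\<close>

definition flag_lower :: "'a set set \<Rightarrow> 'a \<Rightarrow> 'a set" where
  "flag_lower \<C> v = \<Union>{X \<in> \<C>. v \<notin> X}"

definition flag_upper :: "'a set set \<Rightarrow> 'a \<Rightarrow> 'a set" where
  "flag_upper \<C> v = \<Inter>{X \<in> \<C>. v \<in> X}"

text \<open>Unions and intersections are taken because a chain need not have a last member without
  \<open>v\<close> or a first member with \<open>v\<close>. Keeping only the cuts at nonzero vectors
  guarantees that each member of the flag belongs to a pair.\<close>

definition flag_of :: "'a::zero set set \<Rightarrow> 'a set set" where
  "flag_of \<C> = flag_lower \<C> ` (- {0}) \<union> flag_upper \<C> ` (- {0})"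

lemma not_in_flag_lower: "v \<notin> flag_lower \<C> v"
  by (auto simp: flag_lower_def)

lemma in_flag_upper: "v \<in> flag_upper \<C> v"
  by (auto simp: flag_upper_def)

lemma flag_of_cases:
  assumes "F \<in> flag_of \<C>"
  obtains v where "v \<noteq> 0" "F = flag_lower \<C> v \<or> F = flag_upper \<C> v"
  using assms unfolding flag_of_def by (elim UnE imageE) simp_all

text \<open>\<open>H\<close> is a union or an intersection of chain members, and testing these for
  \<open>v\<close> places \<open>H\<close> on one side of the cut. So nothing of the flag lies
  strictly inside a cut.\<close>

lemma flag_of_member_dichotomy:
  assumes "H \<in> flag_of \<C>"
  shows "(v \<notin> H \<and> H \<subseteq> flag_lower \<C> v) \<or> (v \<in> H \<and> flag_upper \<C> v \<subseteq> H)"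
  using assms by (auto simp: flag_of_def flag_lower_def flag_upper_def)

context complex_space
begin

context
  fixes \<C>
  assumes sub: "\<And>X. X \<in> \<C> \<Longrightarrow> subspace X" and total: "\<And>X Y. X \<in> \<C> \<Longrightarrow> Y \<in> \<C> \<Longrightarrow> X \<subseteq> Y \<or> Y \<subseteq> X"
    and zero_mem: "{0} \<in> \<C>"
begin

lemma flag_lower_subset_upper: "flag_lower \<C> v \<subseteq> flag_upper \<C> v"
proof
  fix u assume "u \<in> flag_lower \<C> v"
  then obtain X where X: "X \<in> \<C>" "v \<notin> X" "u \<in> X" by (auto simp: flag_lower_def)
  have "X \<subseteq> Y" if "Y \<in> \<C>" "v \<in> Y" for Y using total[OF X(1) that(1)] X(2) that(2) by blast
  thus "u \<in> flag_upper \<C> v" using X by (auto simp: flag_upper_def)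
qed

lemma flag_lower_psubset_upper: "flag_lower \<C> v \<subset> flag_upper \<C> v"
  using flag_lower_subset_upper[of v] not_in_flag_lower[of v \<C>] in_flag_upper[of v \<C>] by blast

lemma subspace_flag_upper: "subspace (flag_upper \<C> v)"
  unfolding flag_upper_def using sub by (intro subspace_Inter) auto

lemma subspace_flag_lower:
  assumes "v \<noteq> 0"
  shows "subspace (flag_lower \<C> v)"
proof (rule subspaceI)
  show "0 \<in> flag_lower \<C> v" using assms zero_mem by (auto simp: flag_lower_def)
next
  fix x y assume "x \<in> flag_lower \<C> v" "y \<in> flag_lower \<C> v"
  then obtain X Y where XY: "X \<in> \<C>" "v \<notin> X" "x \<in> X" "Y \<in> \<C>" "v \<notin> Y" "y \<in> Y"
    by (auto simp: flag_lower_def)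
  then obtain Z where "Z \<in> \<C>" "v \<notin> Z" "x \<in> Z" "y \<in> Z" using total[OF XY(1,4)] by blast
  hence "Z \<in> \<C>" "v \<notin> Z" "x + y \<in> Z" using subspace_add[OF sub] by auto
  thus "x + y \<in> flag_lower \<C> v" by (auto simp: flag_lower_def)
next
  fix c x assume "x \<in> flag_lower \<C> v"
  thus "scale c x \<in> flag_lower \<C> v" using subspace_scale[OF sub] by (auto simp: flag_lower_def)
qed

lemma subspace_flag_of: "F \<in> flag_of \<C> \<Longrightarrow> subspace F"
  using subspace_flag_lower subspace_flag_upper by (fastforce simp: flag_of_def)

lemma flag_of_pair:
  assumes "v \<noteq> 0"
  shows "(flag_lower \<C> v, flag_upper \<C> v) \<in> flag_pairs (flag_of \<C>)"
proof -
  have "\<not> (flag_lower \<C> v \<subset> H \<and> H \<subset> flag_upper \<C> v)" if "H \<in> flag_of \<C>" for H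
    using flag_of_member_dichotomy[OF that, of v] by blast
  moreover have "flag_lower \<C> v \<in> flag_of \<C>" "flag_upper \<C> v \<in> flag_of \<C>"
    using assms by (simp_all add: flag_of_def)
  ultimately show ?thesis using flag_lower_psubset_upper[of v] unfolding flag_pairs_def by blast
qed

text \<open>Any \<open>v\<close> in \<open>B\<close> but not in \<open>A\<close> works: its cut lies
  between \<open>A\<close> and \<open>B\<close>, and immediacy forces equality at both ends.\<close>

lemma flag_pairs_flag_of:
  assumes "(A, B) \<in> flag_pairs (flag_of \<C>)"
  obtains v where "v \<noteq> 0" "A = flag_lower \<C> v" "B = flag_upper \<C> v"
proof -
  from assms have A: "A \<in> flag_of \<C>" and B: "B \<in> flag_of \<C>" and AB: "A \<subset> B"
    and cons: "\<And>H. H \<in> flag_of \<C> \<Longrightarrow> A \<subset> H \<Longrightarrow> H \<subset> B \<Longrightarrow> False"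
    by (auto simp: flag_pairs_def)
  from AB obtain v where v: "v \<in> B" "v \<notin> A" by blast
  have v0: "v \<noteq> 0" using v(2) subspace_0[OF subspace_flag_of[OF A]] by blast
  have 1: "A \<subseteq> flag_lower \<C> v" using flag_of_member_dichotomy[OF A, of v] v by blast
  have 2: "flag_upper \<C> v \<subseteq> B" using flag_of_member_dichotomy[OF B, of v] v by blast
  note 3 = flag_lower_psubset_upper[of v]
  have "flag_lower \<C> v \<in> flag_of \<C>" "flag_upper \<C> v \<in> flag_of \<C>" using v0 by (auto simp: flag_of_def)
  hence "A = flag_lower \<C> v" "B = flag_upper \<C> v"
    using cons[of "flag_lower \<C> v"] cons[of "flag_upper \<C> v"] 1 2 3 by auto
  with v0 show thesis by (rule that)
qed

lemma gen_flag_flag_of: "gen_flag scale (flag_of \<C>)"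
proof -
  have tot: "A \<subseteq> B \<or> B \<subseteq> A" if A: "A \<in> flag_of \<C>" and B: "B \<in> flag_of \<C>" for A B
  proof (rule disjCI)
    assume "\<not> B \<subseteq> A"
    then obtain v where v: "v \<in> B" "v \<notin> A" by blast
    have "A \<subseteq> flag_lower \<C> v" using flag_of_member_dichotomy[OF A, of v] v by blast
    also have "\<dots> \<subseteq> flag_upper \<C> v" by (rule flag_lower_subset_upper)
    also have "\<dots> \<subseteq> B" using flag_of_member_dichotomy[OF B, of v] v by blast
    finally show "A \<subseteq> B" .
  qed
  have mem: "\<exists>(A,B)\<in>flag_pairs (flag_of \<C>). F = A \<or> F = B" if F: "F \<in> flag_of \<C>" for F
  proof -
    obtain v where "v \<noteq> 0" "F = flag_lower \<C> v \<or> F = flag_upper \<C> v"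
      by (rule flag_of_cases[OF F])
    with flag_of_pair[of v] show ?thesis by (intro bexI[of _ "(flag_lower \<C> v, flag_upper \<C> v)"]) auto
  qed
  have vec: "\<exists>(A,B)\<in>flag_pairs (flag_of \<C>). v \<in> B \<and> v \<notin> A" if "v \<noteq> 0" for v
    using flag_of_pair[OF that] not_in_flag_lower[of v \<C>] in_flag_upper[of v \<C>]
    by (intro bexI[of _ "(flag_lower \<C> v, flag_upper \<C> v)"]) auto
  show ?thesis
    unfolding gen_flag_def by (intro conjI ballI allI impI subspace_flag_of tot mem vec)
qed

end
end

text \<open>Formulated for sets of operators, so that the actions of \<open>k\<close> on
  \<open>V\<close> and on \<open>V_*\<close> are treated alike.\<close>

definition stable_under :: "('a \<Rightarrow> 'a) set \<Rightarrow> 'a set \<Rightarrow> bool" where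
  "stable_under K X \<longleftrightarrow> (\<forall>f\<in>K. f ` X \<subseteq> X)"

lemma stableD: "stable_under K X \<Longrightarrow> f \<in> K \<Longrightarrow> u \<in> X \<Longrightarrow> f u \<in> X"
  by (auto simp: stable_under_def)

lemma stable_Union: "(\<And>X. X \<in> \<X> \<Longrightarrow> stable_under K X) \<Longrightarrow> stable_under K (\<Union>\<X>)"
  unfolding stable_under_def by blast

lemma stable_Inter: "(\<And>X. X \<in> \<X> \<Longrightarrow> stable_under K X) \<Longrightarrow> stable_under K (\<Inter>\<X>)"
  unfolding stable_under_def by blast

definition min_over :: "(complex \<Rightarrow> 'a::ab_group_add \<Rightarrow> 'a) \<Rightarrow> ('a \<Rightarrow> 'a) set
    \<Rightarrow> 'a set \<Rightarrow> 'a set \<Rightarrow> 'a set \<Rightarrow> bool" where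
  "min_over s K Y Z M \<longleftrightarrow> module.subspace s M \<and> stable_under K M \<and> Y \<subset> M \<and> M \<subseteq> Z \<and>
     (\<forall>N. module.subspace s N \<longrightarrow> stable_under K N \<longrightarrow> Y \<subset> N \<longrightarrow> N \<subseteq> Z \<longrightarrow> M \<subseteq> N)"

text \<open>Ranging over all \<open>Y\<close> and \<open>Z\<close> avoids speaking of neighbours in
  the chain; leastness alone keeps the enlarged family totally ordered.\<close>

definition refine :: "(complex \<Rightarrow> 'a::ab_group_add \<Rightarrow> 'a) \<Rightarrow> ('a \<Rightarrow> 'a) set
    \<Rightarrow> 'a set set \<Rightarrow> 'a set set" where
  "refine s K \<C> = \<C> \<union> {M. \<exists>Y\<in>\<C>. \<exists>Z\<in>\<C>. min_over s K Y Z M}"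

section \<open>Closure with respect to a nondegenerate pairing\<close>

locale dual_pair = V: complex_space s1 + W: complex_space s2
  for s1 :: "complex \<Rightarrow> 'v::ab_group_add \<Rightarrow> 'v" and s2 :: "complex \<Rightarrow> 'w::ab_group_add \<Rightarrow> 'w" +
  fixes p :: "'v \<Rightarrow> 'w \<Rightarrow> complex"
  assumes pairing: "nondeg_pairing s1 s2 p"
begin

lemma p_add_left: "p (u + u') y = p u y + p u' y"
  and p_scale_left: "p (s1 c u) y = c * p u y"
  and p_add_right: "p u (y + y') = p u y + p u y'"
  and p_scale_right: "p u (s2 c y) = c * p u y"
  and nondeg_left: "(\<And>y. p u y = 0) \<Longrightarrow> u = 0"
  and nondeg_right: "(\<And>u. p u y = 0) \<Longrightarrow> y = 0"
  using pairing[unfolded nondeg_pairing_def] by (elim conjE; simp)+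

lemma p_zero_left: "p 0 y = 0" and p_zero_right: "p u 0 = 0"
  using p_scale_left[of 0 0] p_scale_right[of _ 0 0] by auto

lemma p_diff_left: "p (u - u') y = p u y - p u' y"
  using p_add_left[of "u - u'" u'] by (simp add: algebra_simps)

lemma p_diff_right: "p u (y - y') = p u y - p u y'"
  using p_add_right[of u "y - y'" y'] by (simp add: algebra_simps)

lemma p_minus_right: "p u (- y) = - p u y"
  using p_diff_right[of u 0 y] by (simp add: p_zero_right)

text \<open>Nondegeneracy is symmetric, so each result about subspaces of \<open>V\<close> transfers
  to \<open>V_*\<close> with \<open>perpV\<close> and \<open>perpW\<close> exchanged.\<close>

lemma flip: "dual_pair s2 s1 (\<lambda>y u. p u y)"
proof unfold_locales
  show "nondeg_pairing s2 s1 (\<lambda>y u. p u y)"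
    unfolding nondeg_pairing_def
    by (intro conjI allI impI p_add_left p_add_right p_scale_left p_scale_right)
      (rule nondeg_right nondeg_left; erule spec)+
qed

text \<open>The operators on \<open>V\<close> that come from tensors. Isolating one component of an
  element of \<open>gl\<close> lets the closure arguments run on either side of the pairing.\<close>

definition fin_op :: "('v \<Rightarrow> 'v) \<Rightarrow> bool" where
  "fin_op f \<longleftrightarrow> (\<exists>ts. f = (\<lambda>u. \<Sum>(v, w)\<leftarrow>ts. s1 (p u w) v))"

lemma fin_op_linear: "fin_op f \<Longrightarrow> Vector_Spaces.linear s1 s1 f"
proof -
  have "Vector_Spaces.linear s1 s1 (\<lambda>u. \<Sum>(v, w)\<leftarrow>ts. s1 (p u w) v)" for ts
  proof (induction ts)
    case Nil show ?case by (simp add: V.vector_space_axioms Vector_Spaces.linear_iff)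
  next
    case (Cons t ts)
    then show ?case
      by (cases t) (auto simp: Vector_Spaces.linear_iff p_add_left p_scale_left V.scale_left_distrib
          V.scale_right_distrib add_ac)
  qed
  thus "fin_op f \<Longrightarrow> Vector_Spaces.linear s1 s1 f" by (auto simp: fin_op_def)
qed

lemma subspace_perpV: "W.subspace (perpV p X)"
  by (rule W.subspaceI) (auto simp: perpV_def p_zero_right p_add_right p_scale_right)

lemma subspace_perpW: "V.subspace (perpW p Y)"
  by (rule V.subspaceI) (auto simp: perpW_def p_zero_left p_add_left p_scale_left)

lemma subset_closureV: "X \<subseteq> closureV p X"
  by (auto simp: closureV_def perpV_def perpW_def)

lemma closureV_mono: "X \<subseteq> Y \<Longrightarrow> closureV p X \<subseteq> closureV p Y"
  by (auto simp: closureV_def perpV_def perpW_def)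

lemma perpV_antimono: "X \<subseteq> Y \<Longrightarrow> perpV p Y \<subseteq> perpV p X"
  by (auto simp: perpV_def)

lemma closureV_idem: "closureV p (closureV p X) = closureV p X"
  by (auto simp: closureV_def perpV_def perpW_def)

lemma perpV_closureV: "perpV p (closureV p X) = perpV p X"
  by (auto simp: closureV_def perpV_def perpW_def)

lemma closedV_closureV: "closedV p (closureV p X)"
  by (simp add: closedV_def closureV_idem)

lemma closureV_subset: "closedV p Y \<Longrightarrow> X \<subseteq> Y \<Longrightarrow> closureV p X \<subseteq> Y"
  using closureV_mono closedV_def by metis

lemma subspace_closureV: "V.subspace (closureV p X)"
  unfolding closureV_def by (rule subspace_perpW)

text \<open>Induction on the functionals. If \<open>w\<close> vanishes on \<open>M\<close>, it
  vanishes at \<open>u\<close> too. Otherwise it is normalized by a vector \<open>m1\<close> of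
  \<open>M\<close>, and the induction continues in the kernel \<open>M1\<close> of \<open>w\<close>
  on \<open>M\<close>, with \<open>u\<close> corrected by a multiple of \<open>m1\<close>.\<close>

lemma dense_approximation:
  assumes "V.subspace M" "u \<in> closureV p M"
  shows "\<exists>m\<in>M. \<forall>w\<in>set ws. p m w = p u w"
  using assms
proof (induction ws arbitrary: M u)
  case Nil
  then show ?case using V.subspace_0 by auto
next
  case (Cons w ws)
  show ?case
  proof (cases "w \<in> perpV p M")
    case True
    obtain m where m: "m \<in> M" "\<forall>w\<in>set ws. p m w = p u w" using Cons.IH[OF Cons.prems] by blast
    moreover have "p u w = 0" using True Cons.prems(2) by (auto simp: closureV_def perpW_def)
    moreover have "p m w = 0" using True m(1) by (auto simp: perpV_def)
    ultimately show ?thesis by auto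
  next
    case False
    then obtain m0 where m0: "m0 \<in> M" "p m0 w \<noteq> 0" by (auto simp: perpV_def)
    define m1 where "m1 = s1 (1 / p m0 w) m0"
    have m1: "m1 \<in> M" "p m1 w = 1"
      using m0 V.subspace_scale[OF Cons.prems(1)] by (auto simp: m1_def p_scale_left)
    define M1 where "M1 = {m \<in> M. p m w = 0}"
    define u1 where "u1 = u - s1 (p u w) m1"
    have sub: "V.subspace M1"
      using Cons.prems(1) by (auto simp: M1_def V.subspace_def p_zero_left p_add_left p_scale_left)
    have "u1 \<in> closureV p M1"
      unfolding closureV_def perpW_def
    proof clarify
      fix y assume y: "y \<in> perpV p M1"
      \<comment> \<open>Each \<open>m\<close> is an element of \<open>M1\<close> plus a multiple of
        \<open>m1\<close>; subtracting this multiple of \<open>w\<close> makes the functional vanish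
        at \<open>m1\<close> as well.\<close>
      have "y - s2 (p m1 y) w \<in> perpV p M"
        unfolding perpV_def
      proof clarify
        fix m assume m: "m \<in> M"
        have "m - s1 (p m w) m1 \<in> M1"
          using m m1 V.subspace_diff[OF Cons.prems(1)] V.subspace_scale[OF Cons.prems(1)]
          by (auto simp: M1_def p_diff_left p_scale_left)
        hence "p (m - s1 (p m w) m1) y = 0" using y by (auto simp: perpV_def)
        thus "p m (y - s2 (p m1 y) w) = 0"
          by (simp add: p_diff_left p_diff_right p_scale_left p_scale_right mult.commute)
      qed
      hence "p u (y - s2 (p m1 y) w) = 0" using Cons.prems(2) by (auto simp: closureV_def perpW_def)
      thus "p u1 y = 0"
        by (simp add: u1_def p_diff_left p_diff_right p_scale_left p_scale_right mult.commute)
    qed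
    from Cons.IH[OF sub this] obtain m' where m': "m' \<in> M1" "\<forall>w\<in>set ws. p m' w = p u1 w" by blast
    let ?m = "m' + s1 (p u w) m1"
    have "?m \<in> M" using m' m1 V.subspace_add[OF Cons.prems(1)] V.subspace_scale[OF Cons.prems(1)]
      by (auto simp: M1_def)
    moreover have "p ?m w = p u w" using m' m1 by (auto simp: M1_def p_add_left p_scale_left)
    moreover have "\<forall>w'\<in>set ws. p ?m w' = p u w'"
      using m'(2) by (auto simp: u1_def p_add_left p_scale_left p_diff_left)
    ultimately show ?thesis by (intro bexI[of _ ?m]) auto
  qed
qed

text \<open>The value \<open>f u\<close> depends only on finitely many numbers \<open>p u w\<close>,
  and by \<open>dense_approximation\<close> some element of \<open>M\<close> attains the same
  numbers.\<close>

lemma fin_op_closure: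
  assumes "fin_op f" "V.subspace M" "f ` M \<subseteq> N"
  shows "f ` closureV p M \<subseteq> N"
proof clarify
  fix u assume u: "u \<in> closureV p M"
  obtain ts where ts: "f = (\<lambda>u. \<Sum>(v, w)\<leftarrow>ts. s1 (p u w) v)" using assms(1) by (auto simp: fin_op_def)
  obtain m where m: "m \<in> M" "\<forall>w\<in>set (map snd ts). p m w = p u w"
    using dense_approximation[OF assms(2) u, of "map snd ts"] by blast
  have "map (\<lambda>(v, w). s1 (p u w) v) ts = map (\<lambda>(v, w). s1 (p m w) v) ts"
    using m(2) by (intro map_cong) force+
  hence "f u = f m" unfolding ts by (simp only:)
  thus "f u \<in> N" using m(1) assms(3) by auto
qed

definition closed_submodule :: "('v \<Rightarrow> 'v) set \<Rightarrow> 'v set \<Rightarrow> bool" where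
  "closed_submodule K X \<longleftrightarrow> V.subspace X \<and> closedV p X \<and> stable_under K X"

lemma closed_submodule_closureV:
  assumes "\<And>f. f \<in> K \<Longrightarrow> fin_op f" "V.subspace X" "stable_under K X"
  shows "closed_submodule K (closureV p X)"
  unfolding closed_submodule_def stable_under_def
proof (intro conjI ballI subspace_closureV closedV_closureV)
  fix f assume f: "f \<in> K"
  have "f ` X \<subseteq> closureV p X" using assms(3) f subset_closureV[of X] by (auto simp: stable_under_def)
  thus "f ` closureV p X \<subseteq> closureV p X" by (rule fin_op_closure[OF assms(1)[OF f] assms(2)])
qed

lemma closed_submodule_Inter:
  assumes "\<And>X. X \<in> \<X> \<Longrightarrow> closed_submodule K X"
  shows "closed_submodule K (\<Inter>\<X>)"
proof -
  have "closureV p (\<Inter>\<X>) \<subseteq> X" if "X \<in> \<X>" for X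
    by (rule closureV_subset) (use assms[OF that] that in \<open>auto simp: closed_submodule_def\<close>)
  hence "closedV p (\<Inter>\<X>)" using subset_closureV[of "\<Inter>\<X>"] unfolding closedV_def by blast
  moreover have "V.subspace (\<Inter>\<X>)" using assms by (intro V.subspace_Inter) (auto simp: closed_submodule_def)
  moreover have "stable_under K (\<Inter>\<X>)" using assms by (intro stable_Inter) (auto simp: closed_submodule_def)
  ultimately show ?thesis by (simp add: closed_submodule_def)
qed

text \<open>Closedness of \<open>Y\<close> yields \<open>y0\<close> vanishing on \<open>Y\<close>
  but not at \<open>v\<close>. Any \<open>y\<close> vanishing on \<open>Y\<close> becomes, after
  subtracting a multiple of \<open>y0\<close>, a functional vanishing on the whole span, and this
  forces \<open>u - s1 c v\<close> into the closure of \<open>Y\<close>.\<close>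

lemma closedV_extend:
  assumes Y: "V.subspace Y" "closedV p Y" and v: "v \<notin> Y"
  shows "closedV p (V.span (insert v Y))"
proof -
  have "v \<notin> closureV p Y" using Y(2) v by (simp add: closedV_def)
  then obtain y0 where y0: "y0 \<in> perpV p Y" "p v y0 \<noteq> 0" by (auto simp: closureV_def perpW_def)
  have "u \<in> V.span (insert v Y)" if u: "u \<in> closureV p (V.span (insert v Y))" for u
  proof -
    \<comment> \<open>The only possible coefficient of \<open>v\<close>, read off by pairing with
      \<open>y0\<close>.\<close>
    define c where "c = p u y0 / p v y0"
    have "u - s1 c v \<in> closureV p Y"
      unfolding closureV_def perpW_def
    proof clarify
      fix y assume y: "y \<in> perpV p Y"
      let ?z = "y - s2 (p v y / p v y0) y0"
      have "?z \<in> perpV p (V.span (insert v Y))"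
        unfolding perpV_def
      proof clarify
        fix m assume "m \<in> V.span (insert v Y)"
        then obtain k where "m - s1 k v \<in> V.span Y" unfolding V.span_insert by blast
        hence "m - s1 k v \<in> Y" using Y(1) by (simp only: V.span_eq_iff[THEN iffD2])
        hence "p (m - s1 k v) y = 0" "p (m - s1 k v) y0 = 0" using y y0(1) by (auto simp: perpV_def)
        hence "p m y = k * p v y" "p m y0 = k * p v y0" by (simp_all add: p_diff_left p_scale_left)
        thus "p m ?z = 0" using y0(2) by (simp add: p_diff_right p_scale_right)
      qed
      hence "p u ?z = 0" using u by (auto simp: closureV_def perpW_def)
      thus "p (u - s1 c v) y = 0"
        using y0(2) by (simp add: p_diff_left p_diff_right p_scale_left p_scale_right c_def)
    qed
    hence "u - s1 c v \<in> Y" using Y(2) by (simp add: closedV_def)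
    thus ?thesis unfolding V.span_insert using V.span_base by blast
  qed
  thus ?thesis using subset_closureV unfolding closedV_def by blast
qed

text \<open>If \<open>K\<close> maps \<open>Z\<close> into \<open>Y\<close>, every subspace in
  between is a submodule; adding one vector to \<open>Y\<close> then gives a closed submodule, so
  the gap forces \<open>Z\<close> to be one dimension larger than \<open>Y\<close>, and
  \<open>Z\<close> itself is least. Otherwise every submodule strictly above \<open>Y\<close> is
  dense in \<open>Z\<close>, hence contains the images of \<open>Z\<close> under \<open>K\<close> by
  \<open>fin_op_closure\<close>, and the span of \<open>Y\<close> and these images is least.\<close>

lemma min_over_exists:
  assumes ops_fin: "\<And>f. f \<in> K \<Longrightarrow> fin_op f" and Y: "closed_submodule K Y" and Z: "closed_submodule K Z"
    and YZ: "Y \<subset> Z" and gap: "\<And>X. closed_submodule K X \<Longrightarrow> Y \<subset> X \<Longrightarrow> X \<subseteq> Z \<Longrightarrow> X = Z"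
  shows "\<exists>M. min_over s1 K Y Z M"
proof (cases "\<forall>f\<in>K. f ` Z \<subseteq> Y")
  case True
  obtain v where v: "v \<in> Z" "v \<notin> Y" using YZ by blast
  let ?N = "V.span (insert v Y)"
  have sY: "V.subspace Y" and sZ: "V.subspace Z" using Y Z by (auto simp: closed_submodule_def)
  have YN: "insert v Y \<subseteq> ?N" by (rule V.span_superset)
  have NZ: "?N \<subseteq> Z" using v YZ sZ by (intro V.span_minimal) auto
  have "stable_under K ?N" unfolding stable_under_def using True YN NZ by blast
  hence "closed_submodule K ?N" using closedV_extend[OF sY _ v(2)] Y by (auto simp: closed_submodule_def)
  hence N: "?N = Z" by (rule gap) (use YN NZ v in blast)+
  have "Z \<subseteq> M" if M: "V.subspace M" "Y \<subset> M" "M \<subseteq> Z" for M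
  proof -
    obtain m where m: "m \<in> M" "m \<notin> Y" using M(2) by blast
    hence "m \<in> ?N" using M(3) N by blast
    then obtain k where "m - s1 k v \<in> V.span Y" unfolding V.span_insert by blast
    hence k: "m - s1 k v \<in> Y" using sY by (simp only: V.span_eq_iff[THEN iffD2])
    hence k0: "k \<noteq> 0" using m(2) by auto
    have "m - s1 k v \<in> M" using k M(2) by blast
    from V.subspace_diff[OF M(1) m(1) this] have "s1 k v \<in> M" by simp
    hence "s1 (1 / k) (s1 k v) \<in> M" by (rule V.subspace_scale[OF M(1)])
    hence "v \<in> M" using k0 by simp
    hence "?N \<subseteq> M" using M(1,2) by (intro V.span_minimal) auto
    thus ?thesis using N by simp
  qed
  hence "min_over s1 K Y Z Z" using Z YZ by (auto simp: min_over_def closed_submodule_def)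
  thus ?thesis ..
next
  case False
  have sY: "V.subspace Y" and sZ: "V.subspace Z" and stZ: "stable_under K Z"
    using Y Z by (auto simp: closed_submodule_def)
  let ?G = "Y \<union> (\<Union>f\<in>K. f ` Z)"
  let ?M = "V.span ?G"
  have GM: "?G \<subseteq> ?M" by (rule V.span_superset)
  have MZ: "?M \<subseteq> Z" using YZ sZ stableD[OF stZ] by (intro V.span_minimal) auto
  have st: "stable_under K ?M" unfolding stable_under_def using GM MZ by blast
  have "?M \<subseteq> N" if N: "V.subspace N" "stable_under K N" "Y \<subset> N" "N \<subseteq> Z" for N
  proof (rule V.span_minimal[OF _ N(1)])
    have "closureV p N \<subseteq> Z" using Z N(4) by (intro closureV_subset) (auto simp: closed_submodule_def)
    hence eq: "closureV p N = Z"
      by (intro gap closed_submodule_closureV ops_fin N) (use N(3) subset_closureV[of N] in auto)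
    have "f ` Z \<subseteq> N" if "f \<in> K" for f
      using fin_op_closure[OF ops_fin[OF that] N(1), of N] N(2) that eq by (auto simp: stable_under_def)
    thus "?G \<subseteq> N" using N(3) by blast
  qed
  moreover have "Y \<subset> ?M" using False GM by blast
  ultimately have "min_over s1 K Y Z ?M" using MZ st by (auto simp: min_over_def)
  thus ?thesis ..
qed

section \<open>Refining a maximal chain of closed submodules\<close>

definition max_closed_chain :: "('v \<Rightarrow> 'v) set \<Rightarrow> 'v set set \<Rightarrow> bool" where
  "max_closed_chain K \<C> \<longleftrightarrow> (\<forall>X\<in>\<C>. closed_submodule K X) \<and> (\<forall>X\<in>\<C>. \<forall>Y\<in>\<C>. X \<subseteq> Y \<or> Y \<subseteq> X) \<and>
     (\<forall>X. closed_submodule K X \<longrightarrow> (\<forall>Y\<in>\<C>. X \<subseteq> Y \<or> Y \<subseteq> X) \<longrightarrow> X \<in> \<C>)"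

lemma max_closed_chain_exists: "\<exists>\<C>. max_closed_chain K \<C>"
proof -
  obtain \<C> where C: "subset.maxchain {X. closed_submodule K X} \<C>" using subset.Hausdorff by blast
  hence ch: "subset.chain {X. closed_submodule K X} \<C>" by (simp add: subset.maxchain_def)
  have "X \<in> \<C>" if X: "closed_submodule K X" "\<forall>Y\<in>\<C>. X \<subseteq> Y \<or> Y \<subseteq> X" for X
  proof (rule ccontr)
    assume "X \<notin> \<C>"
    moreover have "subset.chain {X. closed_submodule K X} (insert X \<C>)"
      using ch X by (auto simp: subset.chain_def)
    ultimately show False using C by (auto simp: subset.maxchain_def)
  qed
  thus ?thesis using ch 
    unfolding max_closed_chain_def subset.chain_def by (intro exI[of _ \<C>]) blast
qed

context
  fixes K \<C>
  assumes fin_ops: "\<forall>f\<in>K. fin_op f" and C: "max_closed_chain K \<C>"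
begin

lemma ops_fin: "f \<in> K \<Longrightarrow> fin_op f"
  using fin_ops ..

lemma chain_closed: "X \<in> \<C> \<Longrightarrow> closed_submodule K X"
  and chain_total: "X \<in> \<C> \<Longrightarrow> Y \<in> \<C> \<Longrightarrow> X \<subseteq> Y \<or> Y \<subseteq> X"
  and chain_max: "closed_submodule K X \<Longrightarrow> (\<And>Y. Y \<in> \<C> \<Longrightarrow> X \<subseteq> Y \<or> Y \<subseteq> X) \<Longrightarrow> X \<in> \<C>"
proof -
  from C have *: "\<forall>X\<in>\<C>. closed_submodule K X" "\<forall>X\<in>\<C>. \<forall>Y\<in>\<C>. X \<subseteq> Y \<or> Y \<subseteq> X"
    "\<forall>X. closed_submodule K X \<longrightarrow> (\<forall>Y\<in>\<C>. X \<subseteq> Y \<or> Y \<subseteq> X) \<longrightarrow> X \<in> \<C>"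
    unfolding max_closed_chain_def by simp_all
  show "X \<in> \<C> \<Longrightarrow> closed_submodule K X" using *(1) ..
  show "X \<in> \<C> \<Longrightarrow> Y \<in> \<C> \<Longrightarrow> X \<subseteq> Y \<or> Y \<subseteq> X" using *(2) by simp
  show "closed_submodule K X \<Longrightarrow> (\<And>Y. Y \<in> \<C> \<Longrightarrow> X \<subseteq> Y \<or> Y \<subseteq> X) \<Longrightarrow> X \<in> \<C>" using *(3) by simp
qed

lemma chain_subspace: "X \<in> \<C> \<Longrightarrow> V.subspace X"
  using chain_closed by (auto simp: closed_submodule_def)

lemma zero_in_chain: "{0} \<in> \<C>"
proof (rule chain_max)
  have "closedV p {0}"
    using nondeg_left by (auto simp: closedV_def closureV_def perpV_def perpW_def p_zero_left)
  moreover have "f 0 = 0" if "f \<in> K" for f by (rule lin_zero[OF fin_op_linear[OF ops_fin[OF that]]])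
  ultimately show "closed_submodule K {0}" by (auto simp: closed_submodule_def stable_under_def)
qed (use V.subspace_0[OF chain_subspace] in blast)

abbreviation refined where "refined \<equiv> refine s1 K \<C>"

lemma chain_subset_refined: "X \<in> \<C> \<Longrightarrow> X \<in> refined"
  by (simp add: refine_def)

lemma refined_cases:
  assumes "X \<in> refined"
  obtains "X \<in> \<C>" | Y Z where "Y \<in> \<C>" "Z \<in> \<C>" "min_over s1 K Y Z X"
  using assms by (auto simp: refine_def)

lemma refined_submodule: "X \<in> refined \<Longrightarrow> V.subspace X \<and> stable_under K X"
  by (erule refined_cases) (auto simp: min_over_def dest: chain_closed simp: closed_submodule_def)

lemma min_over_least:
  assumes "min_over s1 K Y Z M" "V.subspace N" "stable_under K N" "Y \<subset> N" "N \<subseteq> Z"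
  shows "M \<subseteq> N"
  using assms by (auto simp: min_over_def)

text \<open>A chain member not inside \<open>Y\<close> lies strictly above \<open>Y\<close>. It is
  then either inside \<open>Z\<close>, where leastness applies, or it contains \<open>Z\<close> and
  with it \<open>M\<close>.\<close>

lemma min_over_comparable:
  assumes M: "min_over s1 K Y Z M" and Y: "Y \<in> \<C>" and Z: "Z \<in> \<C>" and X: "X \<in> \<C>"
  shows "X \<subseteq> Y \<or> M \<subseteq> X"
proof (cases "X \<subseteq> Y")
  case False
  hence YX: "Y \<subset> X" using chain_total[OF X Y] by blast
  have sX: "V.subspace X" "stable_under K X" using chain_closed[OF X] by (auto simp: closed_submodule_def)
  show ?thesis
  proof (cases "X \<subseteq> Z")
    case True
    thus ?thesis using min_over_least[OF M sX YX] by blast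
  next
    case False
    thus ?thesis using chain_total[OF X Z] M by (auto simp: min_over_def)
  qed
qed simp

lemma refined_total:
  assumes "X \<in> refined" "X' \<in> refined"
  shows "X \<subseteq> X' \<or> X' \<subseteq> X"
proof -
  have 1: "X \<subseteq> M \<or> M \<subseteq> X" if M: "min_over s1 K Y Z M" and "Y \<in> \<C>" "Z \<in> \<C>" "X \<in> \<C>" for X Y Z M
    using min_over_comparable[OF M that(2-4)] M by (auto simp: min_over_def)
  have 2: "M \<subseteq> M' \<or> M' \<subseteq> M"
    if M: "min_over s1 K Y Z M" "Y \<in> \<C>" "Z \<in> \<C>" and M': "min_over s1 K Y' Z' M'" "Y' \<in> \<C>" "Z' \<in> \<C>"
    for Y Z M Y' Z' M'
  proof -
    \<comment> \<open>\<open>min_over_comparable\<close> used both ways: unless one of the bases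
      \<open>Y\<close>, \<open>Y'\<close> separates the two submodules, the bases coincide.\<close>
    consider "M \<subseteq> Y'" | "M' \<subseteq> Y" | "Y = Y'"
      using min_over_comparable[OF M M'(2)] min_over_comparable[OF M' M(2)] by blast
    thus ?thesis
    proof cases
      case 1 thus ?thesis using M'(1) by (auto simp: min_over_def)
    next
      case 2 thus ?thesis using M(1) by (auto simp: min_over_def)
    next
      case 3
      have "V.subspace M" "stable_under K M" "Y \<subset> M" "M \<subseteq> Z" "V.subspace M'" "stable_under K M'" "Y' \<subset> M'" "M' \<subseteq> Z'"
        using M(1) M'(1) by (auto simp: min_over_def)
      with chain_total[OF M(3) M'(3)] show ?thesis
        using min_over_least[OF M(1), of M'] min_over_least[OF M'(1), of M] 3 by (metis order_trans)
    qed
  qed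
  show ?thesis
  proof (cases rule: refined_cases[OF assms(1)]; cases rule: refined_cases[OF assms(2)])
    assume "X \<in> \<C>" "X' \<in> \<C>"
    thus ?thesis by (rule chain_total)
  next
    fix Y Z assume "X \<in> \<C>" and Y: "Y \<in> \<C>" "Z \<in> \<C>" "min_over s1 K Y Z X'"
    thus ?thesis using 1[OF Y(3,1,2)] by simp
  next
    fix Y Z assume "X' \<in> \<C>" and Y: "Y \<in> \<C>" "Z \<in> \<C>" "min_over s1 K Y Z X"
    thus ?thesis using 1[OF Y(3,1,2), of X'] by (simp add: disj_commute)
  next
    fix Y Z Y' Z' assume Y: "Y \<in> \<C>" "Z \<in> \<C>" "min_over s1 K Y Z X"
      and Y': "Y' \<in> \<C>" "Z' \<in> \<C>" "min_over s1 K Y' Z' X'"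
    show ?thesis by (rule 2[OF Y(3,1,2) Y'(3,1,2)])
  qed
qed

lemma zero_in_refined: "{0} \<in> refined"
  by (rule chain_subset_refined[OF zero_in_chain])

lemma refined_subspace: "X \<in> refined \<Longrightarrow> V.subspace X"
  using refined_submodule by simp

lemma refined_flag:
  shows "flag_lower refined v \<subseteq> flag_upper refined v" and "flag_lower refined v \<subset> flag_upper refined v"
    and "V.subspace (flag_upper refined v)" and "v \<noteq> 0 \<Longrightarrow> V.subspace (flag_lower refined v)"
    and "gen_flag s1 (flag_of refined)"
proof -
  show "flag_lower refined v \<subseteq> flag_upper refined v"
    by (rule V.flag_lower_subset_upper) (simp_all add: refined_subspace refined_total zero_in_refined)
  show "flag_lower refined v \<subset> flag_upper refined v"
    by (rule V.flag_lower_psubset_upper) (simp_all add: refined_subspace refined_total zero_in_refined)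
  show "V.subspace (flag_upper refined v)"
    by (rule V.subspace_flag_upper) (simp_all add: refined_subspace refined_total zero_in_refined)
  show "v \<noteq> 0 \<Longrightarrow> V.subspace (flag_lower refined v)"
    by (rule V.subspace_flag_lower) (simp_all add: refined_subspace refined_total zero_in_refined)
  show "gen_flag s1 (flag_of refined)"
    by (rule V.gen_flag_flag_of) (simp_all add: refined_subspace refined_total zero_in_refined)
qed

lemma refined_pairE:
  assumes "(A, B) \<in> flag_pairs (flag_of refined)"
  obtains v where "v \<noteq> 0" "A = flag_lower refined v" "B = flag_upper refined v"
  by (rule V.flag_pairs_flag_of[of refined A B]) (simp_all add: refined_subspace refined_total zero_in_refined assms that)

lemma flag_lower_stable: "stable_under K (flag_lower refined v)"
  unfolding flag_lower_def using refined_submodule by (intro stable_Union) auto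

lemma flag_upper_stable: "stable_under K (flag_upper refined v)"
  unfolding flag_upper_def using refined_submodule by (intro stable_Inter) auto

lemma subset_flag_lower: "X \<in> refined \<Longrightarrow> v \<notin> X \<Longrightarrow> X \<subseteq> flag_lower refined v"
  by (auto simp: flag_lower_def)

lemma flag_upper_subset: "X \<in> refined \<Longrightarrow> v \<in> X \<Longrightarrow> flag_upper refined v \<subseteq> X"
  by (auto simp: flag_upper_def)

text \<open>A chain member containing \<open>v\<close> contains the upper cut and, being closed, the
  closure of \<open>F\<close>; one without \<open>v\<close> lies inside the lower cut. So the
  closure is comparable with the whole chain, and maximality applies.\<close>

lemma closure_in_chain:
  assumes "V.subspace F" "stable_under K F" "flag_lower refined v \<subseteq> F" "F \<subseteq> flag_upper refined v"
  shows "closureV p F \<in> \<C>"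
proof (rule chain_max)
  show "closed_submodule K (closureV p F)" by (rule closed_submodule_closureV[OF ops_fin assms(1,2)])
next
  fix X assume X: "X \<in> \<C>"
  show "closureV p F \<subseteq> X \<or> X \<subseteq> closureV p F"
  proof (cases "v \<in> X")
    case True
    have "closureV p F \<subseteq> X"
      by (rule closureV_subset) (use chain_closed[OF X] flag_upper_subset[OF chain_subset_refined[OF X] True] assms(4) in
          \<open>auto simp: closed_submodule_def\<close>)
    thus ?thesis ..
  next
    case False
    have "X \<subseteq> flag_lower refined v" by (rule subset_flag_lower[OF chain_subset_refined[OF X] False])
    thus ?thesis using assms(3) subset_closureV[of F] by blast
  qed
qed

lemma closure_flag_in_chain:
  assumes "F \<in> flag_of refined"
  shows "closureV p F \<in> \<C>"
proof -
  obtain v where v: "v \<noteq> 0" "F = flag_lower refined v \<or> F = flag_upper refined v"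
    using assms by (rule flag_of_cases)
  thus ?thesis
    using closure_in_chain[of F v] flag_lower_stable flag_upper_stable refined_flag(1)[of v] refined_flag(3)[of v] refined_flag(4)[of v] by auto
qed

text \<open>The closure of the lower cut belongs to the chain; being larger than the cut, it
  contains \<open>v\<close> and hence the upper cut. Conversely, each refined member
  \<open>X\<close> containing \<open>v\<close> contains the closure. The delicate case is an
  \<open>X\<close> least over some \<open>Y\<close> without \<open>v\<close>: the closed
  \<open>Y\<close> differs from the lower cut, and leastness would put \<open>X\<close> inside that
  cut, away from \<open>v\<close>.\<close>

lemma semiclosed_at:
  assumes v: "v \<noteq> 0" and ncl: "closureV p (flag_lower refined v) \<noteq> flag_lower refined v"
  shows "closureV p (flag_lower refined v) = flag_upper refined v"
proof
  let ?U = "flag_lower refined v" and ?B = "flag_upper refined v"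
  have cl: "closureV p ?U \<in> \<C>"
    by (rule closure_in_chain[of _ v]) (use v refined_flag(1,4)[of v] flag_lower_stable in auto)
  have "v \<in> closureV p ?U"
    using subset_flag_lower[OF chain_subset_refined[OF cl], of v] ncl subset_closureV[of ?U] by blast
  thus "?B \<subseteq> closureV p ?U" by (rule flag_upper_subset[OF chain_subset_refined[OF cl]])
  have step: "closureV p ?U \<subseteq> X" if X: "X \<in> \<C>" "v \<in> X" for X
    by (rule closureV_subset) (use chain_closed[OF X(1)] flag_upper_subset[OF chain_subset_refined[OF X(1)] X(2)] refined_flag(1)[of v] in
          \<open>auto simp: closed_submodule_def\<close>)
  have "closureV p ?U \<subseteq> X" if X: "X \<in> refined" "v \<in> X" for X
    using X(1)
  proof (cases rule: refined_cases)
    case 1 thus ?thesis using step X(2) by blast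
  next
    case (2 Y Z)
    show ?thesis
    proof (cases "v \<in> Y")
      case True
      have "Y \<subset> X" using 2(3) by (auto simp: min_over_def)
      thus ?thesis using step[OF 2(1) True] by blast
    next
      case False
      have YU: "Y \<subseteq> ?U" by (rule subset_flag_lower[OF chain_subset_refined[OF 2(1)] False])
      have UX: "?U \<subseteq> X" using flag_upper_subset[OF X] refined_flag(1)[of v] by blast
      have "closureV p Y = Y" using chain_closed[OF 2(1)] by (auto simp: closed_submodule_def closedV_def)
      hence "Y \<noteq> ?U" using ncl by metis
      hence "X \<subseteq> ?U"
        using YU UX 2(3) refined_flag(4)[OF v] flag_lower_stable
        by (intro min_over_least[OF 2(3)]) (auto simp: min_over_def)
      thus ?thesis using X(2) not_in_flag_lower[of v refined] by blast
    qed
  qed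
  thus "closureV p ?U \<subseteq> ?B" by (auto simp: flag_upper_def)
qed

text \<open>A closed lower cut belongs to the chain, and its neighbour there is \<open>?Z\<close>.
  The least submodule \<open>M\<close> between them was adjoined and contains \<open>v\<close>, so
  the upper cut lies in \<open>M\<close>, while every submodule properly above the lower cut
  contains \<open>M\<close>.\<close>

lemma irreducible_at:
  assumes v: "v \<noteq> 0" and cl: "closureV p (flag_lower refined v) = flag_lower refined v"
    and N: "V.subspace N" "stable_under K N" "flag_lower refined v \<subseteq> N" "N \<subseteq> flag_upper refined v"
  shows "N = flag_lower refined v \<or> N = flag_upper refined v"
proof -
  let ?U = "flag_lower refined v" and ?B = "flag_upper refined v" and ?Z = "\<Inter>{X \<in> \<C>. v \<in> X}"
  have U: "?U \<in> \<C>"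
    using closure_in_chain[of ?U v] cl v refined_flag(1,4)[of v] flag_lower_stable by auto
  have Zc: "closed_submodule K ?Z" by (rule closed_submodule_Inter) (use chain_closed in auto)
  have UX: "?U \<subseteq> X" if "X \<in> \<C>" "v \<in> X" for X
    using flag_upper_subset[OF chain_subset_refined[OF that(1)] that(2)] refined_flag(1)[of v] by blast
  have UZ: "?U \<subset> ?Z" using UX not_in_flag_lower[of v refined] by blast
  have in_C: "X \<in> \<C>" if X: "closed_submodule K X" "?U \<subseteq> X" "X \<subseteq> ?Z" for X
  proof (rule chain_max[OF X(1)])
    fix X' assume X': "X' \<in> \<C>"
    show "X \<subseteq> X' \<or> X' \<subseteq> X"
      using subset_flag_lower[OF chain_subset_refined[OF X'], of v] X(2,3) X' by blast
  qed
  have Z: "?Z \<in> \<C>" by (rule in_C) (use Zc UZ in auto)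
  have "\<exists>M. min_over s1 K ?U ?Z M"
  proof (rule min_over_exists[OF ops_fin chain_closed[OF U] Zc UZ])
    fix X assume X: "closed_submodule K X" "?U \<subset> X" "X \<subseteq> ?Z"
    have "X \<in> \<C>" using in_C X by blast
    moreover have "v \<in> X" using subset_flag_lower[OF chain_subset_refined[OF \<open>X \<in> \<C>\<close>], of v] X(2) by blast
    ultimately show "X = ?Z" using X(3) by blast
  qed
  then obtain M where M: "min_over s1 K ?U ?Z M" ..
  have MD: "M \<in> refined" using M U Z by (auto simp: refine_def)
  have "v \<in> M" using subset_flag_lower[OF MD, of v] M by (auto simp: min_over_def)
  hence BM: "?B \<subseteq> M" by (rule flag_upper_subset[OF MD])
  have MZ: "M \<subseteq> ?Z" using M by (auto simp: min_over_def)
  show ?thesis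
  proof (cases "N = ?U")
    case False
    have "M \<subseteq> N"
      by (rule min_over_least[OF M N(1,2)]) (use N(3,4) False BM MZ in auto)
    thus ?thesis using BM N(4) by blast
  qed simp
qed

lemma flag_of_refine:
  shows "gen_flag s1 (flag_of refined)" and "semiclosedV p (flag_of refined)"
    and "F \<in> flag_of refined \<Longrightarrow> stable_under K F"
    and "(A, B) \<in> flag_pairs (flag_of refined) \<Longrightarrow> closedV p A \<Longrightarrow> irred_quot s1 (\<lambda>f. f) K A B"
proof -
  show "gen_flag s1 (flag_of refined)" by (rule refined_flag(5))
  show "semiclosedV p (flag_of refined)"
    unfolding semiclosedV_def using semiclosed_at by (auto elim!: refined_pairE)
  show "F \<in> flag_of refined \<Longrightarrow> stable_under K F" using flag_lower_stable flag_upper_stable by (auto simp: flag_of_def)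
  assume AB: "(A, B) \<in> flag_pairs (flag_of refined)" and A: "closedV p A"
  obtain v where v: "v \<noteq> 0" "A = flag_lower refined v" "B = flag_upper refined v" by (rule refined_pairE[OF AB])
  have "closureV p (flag_lower refined v) = flag_lower refined v" using A v by (simp add: closedV_def)
  from irreducible_at[OF v(1) this] show "irred_quot s1 (\<lambda>f. f) K A B"
    unfolding irred_quot_def v(2,3)
    using refined_flag(2)[of v] refined_flag(3)[of v] refined_flag(4)[OF v(1)] flag_lower_stable[of v] flag_upper_stable[of v]
    by (auto simp: stable_under_def)
qed

text \<open>A chain member consists of 0 and the upper cuts at its nonzero vectors, so the flag
  determines the chain. The vector 0 has no cut; it is covered by \<open>f 0 = 0\<close>.\<close>

lemma flag_stable_imp_chain_stable:
  assumes "\<And>F. F \<in> flag_of refined \<Longrightarrow> f ` F \<subseteq> F" "f 0 = 0" "X \<in> \<C>"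
  shows "f ` X \<subseteq> X"
proof clarify
  fix v assume v: "v \<in> X"
  show "f v \<in> X"
  proof (cases "v = 0")
    case True thus ?thesis using assms(2) v by simp
  next
    case False
    hence "flag_upper refined v \<in> flag_of refined" by (auto simp: flag_of_def)
    thus ?thesis
      using assms(1)[of "flag_upper refined v"] in_flag_upper[of v refined] flag_upper_subset[OF chain_subset_refined[OF assms(3)] v] by blast
  qed
qed

end
end

section \<open>The locally solvable radical\<close>

lemma derived_mono: "L \<subseteq> L' \<Longrightarrow> derived s1 s2 L \<subseteq> derived s1 s2 L'"
proof -
  assume "L \<subseteq> L'"
  hence "{gl_br x z | x z. x \<in> L \<and> z \<in> L} \<subseteq> {gl_br x z | x z. x \<in> L' \<and> z \<in> L'}" by blast
  thus ?thesis unfolding derived_def gl_span_def 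
    by (intro Inter_anti_mono Collect_mono impI conjI; elim conjE) (assumption | erule (1) order_trans)+
qed

lemma derived_funpow_mono: "L \<subseteq> L' \<Longrightarrow> (derived s1 s2 ^^ n) L \<subseteq> (derived s1 s2 ^^ n) L'"
  by (induction n) (simp_all add: derived_mono)

lemma lie_solvable_mono: "lie_solvable s1 s2 L' \<Longrightarrow> L \<subseteq> L' \<Longrightarrow> lie_solvable s1 s2 L"
  unfolding lie_solvable_def by (erule exE, rule exI, rule order_trans[OF derived_funpow_mono])

lemma gen_subalg_least: "lie_closed s1 s2 T \<Longrightarrow> X \<subseteq> T \<Longrightarrow> gen_subalg s1 s2 X \<subseteq> T"
  unfolding gen_subalg_def by (rule Inter_lower) simp

lemma gen_subalg_superset: "X \<subseteq> gen_subalg s1 s2 X"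
  unfolding gen_subalg_def by (rule Inter_greatest) simp

lemma lie_closed_gen_subalg: "lie_closed s1 s2 (gen_subalg s1 s2 X)"
  by (auto simp: gen_subalg_def lie_closed_def gl_subspace_def)

lemma lie_closed_lie_ideal:
  assumes "lie_ideal s1 s2 k I"
  shows "lie_closed s1 s2 I"
proof -
  from assms have I: "I \<subseteq> k" "gl_subspace s1 s2 I" "\<forall>x\<in>k. \<forall>z\<in>I. gl_br x z \<in> I"
    unfolding lie_ideal_def by simp_all
  show ?thesis unfolding lie_closed_def using I by (intro conjI ballI) (simp_all only: subsetD)
qed

lemma set_plus_memI: "a \<in> A \<Longrightarrow> b \<in> B \<Longrightarrow> a + b \<in> {x + z | x z. x \<in> A \<and> z \<in> B}"
  by blast

lemma gl_add_eq_plus: "gl_add x z = x + z"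
  by (auto simp: gl_add_def plus_fun_def prod_eq_iff)

lemma gl_zero_eq_zero: "gl_zero = 0"
  by (auto simp: gl_zero_def zero_fun_def prod_eq_iff)

section \<open>Brackets and local finiteness of \<open>gl\<close>\<close>

context dual_pair
begin

abbreviation gl where "gl \<equiv> glVV s1 s2 p"
abbreviation simple_tensor where "simple_tensor v w \<equiv> tensor_action s1 s2 p [(v, w)]"
abbreviation der where "der \<equiv> derived s1 s2"

sublocale G: complex_space "gl_smul s1 s2"
  by unfold_locales (auto simp: gl_smul_def prod_eq_iff fun_eq_iff
      V.scale_right_distrib V.scale_left_distrib W.scale_right_distrib W.scale_left_distrib)

lemma gl_subspace_iff: "gl_subspace s1 s2 T \<longleftrightarrow> G.subspace T"
  by (simp add: gl_subspace_def G.subspace_def gl_add_eq_plus gl_zero_eq_zero)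

lemma gl_span_eq: "gl_span s1 s2 X = G.span X"
  by (auto simp: gl_span_def gl_subspace_iff G.span_def hull_def)

lemma derived_eq: "der L = G.span {gl_br x z | x z. x \<in> L \<and> z \<in> L}"
  by (simp add: derived_def gl_span_eq)

lemma derivedI: "x \<in> L \<Longrightarrow> z \<in> L \<Longrightarrow> gl_br x z \<in> der L"
  unfolding derived_eq by (rule G.span_base) blast

lemma derived_minimal:
  assumes "G.subspace T" "\<And>x z. x \<in> L \<Longrightarrow> z \<in> L \<Longrightarrow> gl_br x z \<in> T"
  shows "der L \<subseteq> T"
  unfolding derived_eq using assms by (intro G.span_minimal) auto

lemma fst_gl_smul [simp]: "fst (gl_smul s1 s2 c x) u = s1 c (fst x u)"
  and snd_gl_smul [simp]: "snd (gl_smul s1 s2 c x) y = s2 c (snd x y)"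
  and fst_gl_br [simp]: "fst (gl_br x z) u = fst x (fst z u) - fst z (fst x u)"
  and snd_gl_br [simp]: "snd (gl_br x z) y = snd x (snd z y) - snd z (snd x y)"
  by (simp_all add: gl_smul_def gl_br_def)

lemma gl_eqI: "(\<And>u. fst x u = fst z u) \<Longrightarrow> (\<And>y. snd x y = snd z y) \<Longrightarrow> x = z"
  by (simp add: prod_eq_iff fun_eq_iff)

lemma gl_fin_op: "x \<in> gl \<Longrightarrow> fin_op (fst x)"
  by (auto simp: glVV_def tensor_action_def fin_op_def)

text \<open>The minus sign of the action on \<open>V_*\<close> is absorbed into
  \<open>w\<close>.\<close>

lemma gl_fin_op_snd:
  assumes "x \<in> gl"
  shows "dual_pair.fin_op s2 (\<lambda>y u. p u y) (snd x)"
proof -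
  obtain ts where ts: "x = tensor_action s1 s2 p ts" using assms by (auto simp: glVV_def)
  have "- (\<Sum>(v, w)\<leftarrow>ts. s2 (p v y) w) = (\<Sum>(w, v)\<leftarrow>map (\<lambda>(v, w). (- w, v)) ts. s2 (p v y) w)" for y
    by (induction ts) (auto simp: W.scale_minus_right)
  thus ?thesis unfolding dual_pair.fin_op_def[OF flip] ts tensor_action_def
    by (intro exI[of _ "map (\<lambda>(v, w). (- w, v)) ts"]) (simp only: snd_conv)
qed

lemma gl_linear_fst: "x \<in> gl \<Longrightarrow> Vector_Spaces.linear s1 s1 (fst x)"
  by (rule fin_op_linear[OF gl_fin_op])

lemma gl_linear_snd: "x \<in> gl \<Longrightarrow> Vector_Spaces.linear s2 s2 (snd x)"
  by (rule dual_pair.fin_op_linear[OF flip gl_fin_op_snd])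

lemma gl_adjoint:
  assumes "x \<in> gl"
  shows "p (fst x u) y = - p u (snd x y)"
proof -
  obtain ts where ts: "x = tensor_action s1 s2 p ts" using assms by (auto simp: glVV_def)
  have "p (\<Sum>(v, w)\<leftarrow>ts. s1 (p u w) v) y = p u (\<Sum>(v, w)\<leftarrow>ts. s2 (p v y) w)"
    by (induction ts) (auto simp: p_zero_left p_zero_right p_add_left p_add_right p_scale_left p_scale_right)
  thus ?thesis by (simp add: ts tensor_action_def p_minus_right)
qed

lemma gl_eq_zeroI:
  assumes "x \<in> gl" "\<And>u. fst x u = 0"
  shows "x = gl_zero"
proof -
  have "snd x y = 0" for y
    by (rule nondeg_right) (use gl_adjoint[OF assms(1), of _ y] assms(2) p_zero_left in simp)
  thus ?thesis using assms(2) by (intro gl_eqI) (auto simp: gl_zero_def)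
qed

text \<open>For finite sets this is a finite-dimensional Lie algebra, and for \<open>UNIV\<close> it
  is all of \<open>gl\<close>. The first use gives local finiteness, the second closure of
  \<open>gl\<close> under brackets.\<close>

definition tensors :: "'v set \<Rightarrow> 'w set \<Rightarrow> ('v, 'w) glel set" where
  "tensors Vs Ws = G.span {simple_tensor v w | v w. v \<in> Vs \<and> w \<in> Ws}"

lemma tensor_action_Cons: "tensor_action s1 s2 p ((v, w) # ts) = simple_tensor v w + tensor_action s1 s2 p ts"
  by (rule gl_eqI) (auto simp: tensor_action_def)

lemma tensor_action_in_tensors: "set ts \<subseteq> Vs \<times> Ws \<Longrightarrow> tensor_action s1 s2 p ts \<in> tensors Vs Ws"
proof (induction ts)
  case Nil
  have "tensor_action s1 s2 p [] = 0" by (rule gl_eqI) (auto simp: tensor_action_def)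
  thus ?case by (simp add: tensors_def G.span_zero)
next
  case (Cons t ts)
  obtain v w where t: "t = (v, w)" by (cases t)
  have "simple_tensor v w \<in> tensors Vs Ws"
    unfolding tensors_def using Cons.prems t by (intro G.span_base) auto
  moreover have "tensor_action s1 s2 p ts \<in> tensors Vs Ws" using Cons by simp
  ultimately show ?case unfolding t tensors_def by (subst tensor_action_Cons) (rule G.span_add)
qed

lemma gl_subspace_gl: "G.subspace gl"
proof (rule G.subspaceI)
  have "tensor_action s1 s2 p [] = 0" by (rule gl_eqI) (auto simp: tensor_action_def)
  thus "0 \<in> gl" by (auto simp: glVV_def intro: range_eqI[of _ _ "[]"])
next
  fix x z assume "x \<in> gl" "z \<in> gl"
  then obtain ts ts' where "x = tensor_action s1 s2 p ts" "z = tensor_action s1 s2 p ts'"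
    by (auto simp: glVV_def)
  hence "x + z = tensor_action s1 s2 p (ts @ ts')"
    by (intro gl_eqI) (auto simp: tensor_action_def)
  thus "x + z \<in> gl" by (auto simp: glVV_def)
next
  fix c x assume "x \<in> gl"
  then obtain ts where ts: "x = tensor_action s1 s2 p ts" by (auto simp: glVV_def)
  have 1: "s1 c (\<Sum>(v, w)\<leftarrow>ts. s1 (p u w) v) = (\<Sum>(v, w)\<leftarrow>map (\<lambda>(v, w). (s1 c v, w)) ts. s1 (p u w) v)" for u
    by (induction ts) (auto simp: V.scale_right_distrib mult.commute)
  have 2: "s2 c (\<Sum>(v, w)\<leftarrow>ts. s2 (p v y) w) = (\<Sum>(v, w)\<leftarrow>map (\<lambda>(v, w). (s1 c v, w)) ts. s2 (p v y) w)" for y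
    by (induction ts) (auto simp: W.scale_right_distrib p_scale_left)
  have "gl_smul s1 s2 c x = tensor_action s1 s2 p (map (\<lambda>(v, w). (s1 c v, w)) ts)"
    by (rule gl_eqI) (simp_all only: fst_gl_smul snd_gl_smul ts tensor_action_def fst_conv snd_conv
        W.scale_minus_right 1 2)
  thus "gl_smul s1 s2 c x \<in> gl" by (auto simp: glVV_def)
qed

lemma tensors_subset_gl: "tensors Vs Ws \<subseteq> gl"
  unfolding tensors_def by (rule G.span_minimal[OF _ gl_subspace_gl]) (auto simp: glVV_def)

lemma gl_eq_tensors: "gl = tensors UNIV UNIV"
  using tensors_subset_gl[of UNIV UNIV] tensor_action_in_tensors[of _ UNIV UNIV] by (auto simp: glVV_def)

lemma gl_br_add_right: "x \<in> gl \<Longrightarrow> gl_br x (z + z') = gl_br x z + gl_br x z'"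
  by (rule gl_eqI) (simp_all add: lin_add[OF gl_linear_fst] lin_add[OF gl_linear_snd] algebra_simps)

lemma gl_br_scale_right: "x \<in> gl \<Longrightarrow> gl_br x (gl_smul s1 s2 c z) = gl_smul s1 s2 c (gl_br x z)"
  by (rule gl_eqI) (simp_all add: lin_scale[OF gl_linear_fst] lin_scale[OF gl_linear_snd]
      V.scale_right_diff_distrib W.scale_right_diff_distrib)

lemma gl_br_zero_right: "x \<in> gl \<Longrightarrow> gl_br x 0 = 0"
  by (rule gl_eqI) (simp_all add: lin_zero[OF gl_linear_fst] lin_zero[OF gl_linear_snd])

lemma gl_br_swap: "gl_br x z = gl_smul s1 s2 (-1) (gl_br z x)"
  by (rule gl_eqI) simp_all

lemma gl_br_mem_swap: "G.subspace T \<Longrightarrow> gl_br z x \<in> T \<Longrightarrow> gl_br x z \<in> T"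
  by (subst gl_br_swap) (rule G.subspace_scale)

lemma gl_br_jacobi:
  assumes "x \<in> gl" "y \<in> gl" "z \<in> gl"
  shows "gl_br x (gl_br y z) = gl_br (gl_br x y) z + gl_br y (gl_br x z)"
  using assms
  by (intro gl_eqI) (simp_all add: lin_diff[OF gl_linear_fst] lin_diff[OF gl_linear_snd] algebra_simps)

lemma subspace_br_preimage:
  assumes "x \<in> gl" "G.subspace T"
  shows "G.subspace {z. gl_br x z \<in> T}"
  using assms by (auto simp: G.subspace_def gl_br_add_right gl_br_scale_right gl_br_zero_right)

lemma simple_tensor_br:
  "gl_br (simple_tensor v w) (simple_tensor v' w')
    = gl_smul s1 s2 (p v' w) (simple_tensor v w') - gl_smul s1 s2 (p v w') (simple_tensor v' w)"
  by (rule gl_eqI) (simp_all add: tensor_action_def p_scale_left p_scale_right p_minus_right mult.commute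
      W.scale_minus_right)

text \<open>The bracket of two simple tensors only recombines the given vectors and covectors.
  Linearity extends this to the span, one argument at a time.\<close>

lemma tensors_br_closed:
  assumes "x \<in> tensors Vs Ws" "z \<in> tensors Vs Ws"
  shows "gl_br x z \<in> tensors Vs Ws"
proof -
  let ?S = "{simple_tensor v w | v w. v \<in> Vs \<and> w \<in> Ws}"
  have T: "G.subspace (tensors Vs Ws)" by (simp add: tensors_def)
  have g: "simple_tensor v w \<in> tensors Vs Ws" if "v \<in> Vs" "w \<in> Ws" for v w
    unfolding tensors_def using that by (intro G.span_base) auto
  have st: "simple_tensor v w \<in> gl" for v w by (auto simp: glVV_def)
  have 1: "tensors Vs Ws \<subseteq> {z. gl_br (simple_tensor v w) z \<in> tensors Vs Ws}" if "v \<in> Vs" "w \<in> Ws" for v w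
  proof -
    have "?S \<subseteq> {z. gl_br (simple_tensor v w) z \<in> tensors Vs Ws}"
      using that by (auto simp: simple_tensor_br intro!: G.subspace_diff[OF T] G.subspace_scale[OF T] g)
    thus ?thesis unfolding tensors_def[of Vs Ws, THEN eq_reflection] using subspace_br_preimage[OF st T]
      by (intro G.span_minimal) (auto simp: tensors_def)
  qed
  have zgl: "z \<in> gl" using assms(2) tensors_subset_gl by blast
  have "gl_br z s \<in> tensors Vs Ws" if s: "s \<in> ?S" for s
  proof -
    from s obtain v w where "s = simple_tensor v w" "v \<in> Vs" "w \<in> Ws" by blast
    with subsetD[OF 1 assms(2), of v w] show ?thesis by (metis gl_br_mem_swap[OF T] mem_Collect_eq)
  qed
  hence "tensors Vs Ws \<subseteq> {x. gl_br z x \<in> tensors Vs Ws}"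
    using subspace_br_preimage[OF zgl T] unfolding tensors_def by (intro G.span_minimal) auto
  hence "gl_br z x \<in> tensors Vs Ws" using assms(1) by blast
  thus ?thesis by (rule gl_br_mem_swap[OF T])
qed

lemma lie_closed_tensors: "lie_closed s1 s2 (tensors Vs Ws)"
  using tensors_br_closed by (auto simp: lie_closed_def gl_subspace_iff tensors_def)

lemma gl_br_closed: "x \<in> gl \<Longrightarrow> z \<in> gl \<Longrightarrow> gl_br x z \<in> gl"
  unfolding gl_eq_tensors by (rule tensors_br_closed)

lemma gen_subalg_in_tensors:
  assumes "finite X" "X \<subseteq> gl"
  obtains Vs Ws where "finite Vs" "finite Ws" "gen_subalg s1 s2 X \<subseteq> tensors Vs Ws"
proof -
  have "\<forall>x\<in>X. \<exists>ts. x = tensor_action s1 s2 p ts" using assms(2) by (auto simp: glVV_def)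
  then obtain t where t: "\<And>x. x \<in> X \<Longrightarrow> x = tensor_action s1 s2 p (t x)" by metis
  let ?V = "\<Union>x\<in>X. fst ` set (t x)" and ?W = "\<Union>x\<in>X. snd ` set (t x)"
  have "x \<in> tensors ?V ?W" if "x \<in> X" for x
    by (subst t[OF that], rule tensor_action_in_tensors) (use that in force)
  hence "gen_subalg s1 s2 X \<subseteq> tensors ?V ?W" by (intro gen_subalg_least lie_closed_tensors) auto
  moreover have "finite ?V" "finite ?W" using assms(1) by auto
  ultimately show thesis using that by blast
qed

lemma gen_subalg_fin_dim:
  assumes "finite X" "X \<subseteq> gl"
  shows "\<exists>Z. finite Z \<and> gen_subalg s1 s2 X \<subseteq> G.span Z"
proof -
  obtain Vs Ws where VW: "finite Vs" "finite Ws" "gen_subalg s1 s2 X \<subseteq> tensors Vs Ws"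
    by (rule gen_subalg_in_tensors[OF assms])
  have "{simple_tensor v w | v w. v \<in> Vs \<and> w \<in> Ws} = (\<lambda>(v, w). simple_tensor v w) ` (Vs \<times> Ws)" by auto
  hence "finite {simple_tensor v w | v w. v \<in> Vs \<and> w \<in> Ws}" using VW(1,2) by simp
  thus ?thesis using VW(3) unfolding tensors_def by blast
qed

lemma gen_subalg_fin_image:
  assumes "finite X" "X \<subseteq> gl"
  shows "\<exists>E. finite E \<and> (\<forall>x\<in>gen_subalg s1 s2 X. \<forall>u. fst x u \<in> V.span E)"
proof -
  obtain Vs Ws where VW: "finite Vs" "finite Ws" "gen_subalg s1 s2 X \<subseteq> tensors Vs Ws"
    by (rule gen_subalg_in_tensors[OF assms])
  have "G.subspace {x. \<forall>u. fst x u \<in> V.span Vs}"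
    by (auto simp: G.subspace_def intro: V.span_add V.span_scale V.span_zero)
  hence "tensors Vs Ws \<subseteq> {x. \<forall>u. fst x u \<in> V.span Vs}"
    unfolding tensors_def by (intro G.span_minimal) (auto simp: tensor_action_def intro!: V.span_scale[OF V.span_base])
  thus ?thesis using VW by blast
qed

text \<open>Local solvability concerns finitely generated subalgebras; a set of finite-dimensional
  span lies in the subalgebra generated by a finite independent subset.\<close>

lemma lie_solvable_of_locally_solvable:
  assumes "locally_solvable s1 s2 I" "M \<subseteq> I" "M \<subseteq> G.span Z" "finite Z"
  shows "lie_solvable s1 s2 M"
proof -
  obtain S where S: "S \<subseteq> M" "G.independent S" "M \<subseteq> G.span S"
    by (rule G.basis_exists[of M])
  have "finite S" using G.independent_span_bound[OF assms(4) S(2)] S(1) assms(3) by auto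
  hence "lie_solvable s1 s2 (gen_subalg s1 s2 S)"
    using assms(1,2) S(1) unfolding locally_solvable_def by blast
  moreover have "G.span S \<subseteq> gen_subalg s1 s2 S"
    using lie_closed_gen_subalg[of s1 s2 S] gen_subalg_superset[of S s1 s2]
    by (intro G.span_minimal) (auto simp: lie_closed_def gl_subspace_iff)
  ultimately show ?thesis using S(3) by (meson lie_solvable_mono order_trans)
qed

section \<open>Ideals of a subalgebra and their sums\<close>

context
  fixes L
  assumes L: "gl_subalgebra s1 s2 p L"
begin

lemma subalgebra_gl: "x \<in> L \<Longrightarrow> x \<in> gl"
  and subalgebra_br: "x \<in> L \<Longrightarrow> z \<in> L \<Longrightarrow> gl_br x z \<in> L"
  and subalgebra_subspace: "G.subspace L"
  using L by (auto simp: gl_subalgebra_def lie_closed_def gl_subspace_iff)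

lemma lie_idealD:
  assumes "lie_ideal s1 s2 L J"
  shows "x \<in> J \<Longrightarrow> x \<in> L" "G.subspace J" "x \<in> L \<Longrightarrow> z \<in> J \<Longrightarrow> gl_br x z \<in> J"
    "x \<in> L \<Longrightarrow> z \<in> J \<Longrightarrow> gl_br z x \<in> J"
proof -
  show 1: "x \<in> J \<Longrightarrow> x \<in> L" "G.subspace J" "x \<in> L \<Longrightarrow> z \<in> J \<Longrightarrow> gl_br x z \<in> J"
    using assms by (auto simp: lie_ideal_def gl_subspace_iff)
  show "x \<in> L \<Longrightarrow> z \<in> J \<Longrightarrow> gl_br z x \<in> J"
    by (rule gl_br_mem_swap[OF 1(2)]) (rule 1(3))
qed

lemma derived_ideal_subset: "lie_ideal s1 s2 L J \<Longrightarrow> der J \<subseteq> J"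
  using lie_idealD by (intro derived_minimal) auto

lemma derived_ideal:
  assumes J: "lie_ideal s1 s2 L J"
  shows "lie_ideal s1 s2 L (der J)"
proof -
  note J' = lie_idealD[OF J]
  have sub: "G.subspace (der J)" by (simp add: derived_eq)
  have "der J \<subseteq> {z. gl_br x z \<in> der J}" if x: "x \<in> L" for x
  proof (rule derived_minimal)
    show "G.subspace {z. gl_br x z \<in> der J}" by (rule subspace_br_preimage[OF subalgebra_gl[OF x] sub])
  next
    fix a b assume ab: "a \<in> J" "b \<in> J"
    have "gl_br x (gl_br a b) = gl_br (gl_br x a) b + gl_br a (gl_br x b)"
      by (rule gl_br_jacobi) (use x ab J'(1) subalgebra_gl in auto)
    also have "\<dots> \<in> der J"
      by (rule G.subspace_add[OF sub]; rule derivedI) (use x ab J' in auto)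
    finally show "gl_br a b \<in> {z. gl_br x z \<in> der J}" by simp
  qed
  moreover have "der J \<subseteq> L" using derived_ideal_subset[OF J] J'(1) by blast
  ultimately show ?thesis using sub by (auto simp: lie_ideal_def gl_subspace_iff)
qed

lemma derived_funpow_ideal:
  "lie_ideal s1 s2 L J \<Longrightarrow> lie_ideal s1 s2 L ((der ^^ n) J) \<and> (der ^^ n) J \<subseteq> J"
  by (induction n) (auto dest: derived_ideal derived_ideal_subset)

lemma subspace_plus:
  "G.subspace I \<Longrightarrow> G.subspace J \<Longrightarrow> G.subspace {x + z | x z. x \<in> I \<and> z \<in> J}"
  by (rule G.subspace_sums)

lemma ideal_plus:
  assumes I: "lie_ideal s1 s2 L I" and J: "lie_ideal s1 s2 L J"
  shows "lie_ideal s1 s2 L {x + z | x z. x \<in> I \<and> z \<in> J}"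
proof -
  note I' = lie_idealD[OF I] and J' = lie_idealD[OF J]
  have "{x + z | x z. x \<in> I \<and> z \<in> J} \<subseteq> L" using I'(1) J'(1) G.subspace_add[OF subalgebra_subspace] by blast
  moreover have "gl_br y (x + z) \<in> {x + z | x z. x \<in> I \<and> z \<in> J}" if "y \<in> L" "x \<in> I" "z \<in> J" for x y z
    unfolding gl_br_add_right[OF subalgebra_gl[OF that(1)]] using I'(3) J'(3) that by blast
  ultimately show ?thesis
    using subspace_plus[OF I'(2) J'(2)] unfolding lie_ideal_def gl_subspace_iff by blast
qed

text \<open>Brackets with a factor in \<open>J\<close> stay in \<open>J\<close>, so the derived
  series of the sum follows that of \<open>I\<close> up to an error in \<open>J\<close>. Once
  \<open>I\<close> has died out, the derived series of \<open>J\<close> finishes the argument. This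
  replaces passing to the quotient by \<open>J\<close>.\<close>

lemma solvable_plus:
  assumes I: "lie_ideal s1 s2 L I" "lie_solvable s1 s2 I" and J: "lie_ideal s1 s2 L J" "lie_solvable s1 s2 J"
  shows "lie_solvable s1 s2 {x + z | x z. x \<in> I \<and> z \<in> J}"
proof -
  let ?S = "\<lambda>A. {x + z | x z. x \<in> A \<and> z \<in> J}"
  note J' = lie_idealD[OF J(1)]
  have step: "der (?S A) \<subseteq> ?S (der A)" if A: "lie_ideal s1 s2 L A" for A
  proof (rule derived_minimal)
    note A' = lie_idealD[OF A]
    show "G.subspace (?S (der A))"
      by (rule subspace_plus[OF _ J'(2)]) (simp add: derived_eq)
    fix x z assume "x \<in> ?S A" "z \<in> ?S A"
    then obtain a j b l where x: "x = a + j" "a \<in> A" "j \<in> J" and z: "z = b + l" "b \<in> A" "l \<in> J"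
      by blast
    have gl: "a \<in> gl" "j \<in> gl" "b \<in> gl" "l \<in> gl" using x z A'(1) J'(1) subalgebra_gl by auto
    have "gl_br x z = gl_br a b + (gl_br a l + gl_br j b + gl_br j l)"
      unfolding x z using gl
      by (intro gl_eqI) (simp_all add: lin_add[OF gl_linear_fst] lin_add[OF gl_linear_snd] algebra_simps)
    moreover have "gl_br a l + gl_br j b + gl_br j l \<in> J"
      using x z A'(1) J' by (intro G.subspace_add[OF J'(2)]) auto
    ultimately show "gl_br x z \<in> ?S (der A)" using derivedI[OF x(2) z(2)] by blast
  qed
  have "(der ^^ n) (?S I) \<subseteq> ?S ((der ^^ n) I)" for n
  proof (induction n)
    case (Suc n)
    have "(der ^^ Suc n) (?S I) \<subseteq> der (?S ((der ^^ n) I))" using derived_mono[OF Suc.IH] by simp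
    also have "\<dots> \<subseteq> ?S ((der ^^ Suc n) I)" using step derived_funpow_ideal[OF I(1), of n] by simp
    finally show ?case .
  qed simp
  moreover obtain n where "(der ^^ n) I \<subseteq> {gl_zero}" using I(2) by (auto simp: lie_solvable_def)
  ultimately have "(der ^^ n) (?S I) \<subseteq> J" by (fastforce simp: gl_zero_eq_zero)
  moreover obtain m where "(der ^^ m) J \<subseteq> {gl_zero}" using J(2) by (auto simp: lie_solvable_def)
  ultimately have "(der ^^ m) ((der ^^ n) (?S I)) \<subseteq> {gl_zero}"
    using derived_funpow_mono by (meson order_trans)
  hence "(der ^^ (m + n)) (?S I) \<subseteq> {gl_zero}" by (simp add: funpow_add)
  thus ?thesis unfolding lie_solvable_def by blast
qed

end

lemma gen_subalg_subalgebra: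
  assumes "X \<subseteq> gl"
  shows "gl_subalgebra s1 s2 p (gen_subalg s1 s2 X)"
  using gen_subalg_least[OF lie_closed_tensors[of UNIV UNIV], of X] assms lie_closed_gen_subalg
  unfolding gl_subalgebra_def gl_eq_tensors by blast

text \<open>Cuts a locally solvable ideal down to a solvable ideal of a finite-dimensional algebra,
  the setting for sums of ideals and for Lie's theorem.\<close>

lemma ideal_Int_gen_subalg:
  assumes k: "gl_subalgebra s1 s2 p k" and I: "lie_ideal s1 s2 k I" "locally_solvable s1 s2 I"
    and X: "finite X" "X \<subseteq> k"
  shows "gen_subalg s1 s2 X \<subseteq> k" "lie_ideal s1 s2 (gen_subalg s1 s2 X) (gen_subalg s1 s2 X \<inter> I)"
    "lie_solvable s1 s2 (gen_subalg s1 s2 X \<inter> I)"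
proof -
  let ?L = "gen_subalg s1 s2 X"
  show Lk: "?L \<subseteq> k" using k X(2) by (intro gen_subalg_least) (auto simp: gl_subalgebra_def)
  have kgl: "X \<subseteq> gl" using k X(2) by (auto simp: gl_subalgebra_def)
  have L: "gl_subalgebra s1 s2 p ?L" by (rule gen_subalg_subalgebra[OF kgl])
  note I' = lie_idealD[OF k I(1)]
  show "lie_ideal s1 s2 ?L (?L \<inter> I)"
    using I'(2) I'(3) Lk subalgebra_br[OF L] subalgebra_subspace[OF L] G.subspace_inter[of ?L I]
    by (auto simp: lie_ideal_def gl_subspace_iff)
  obtain Z where "finite Z" "?L \<subseteq> G.span Z" using gen_subalg_fin_dim[OF X(1) kgl] by blast
  thus "lie_solvable s1 s2 (?L \<inter> I)" by (intro lie_solvable_of_locally_solvable[OF I(2), of _ Z]) auto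
qed

text \<open>The two ideals may fail to be solvable, so the elements of a finite \<open>X\<close> are
  split into components and the sum is formed inside the algebra generated by these components.
  There both intersections are solvable and \<open>solvable_plus\<close> applies.\<close>

lemma locally_solvable_plus:
  assumes k: "gl_subalgebra s1 s2 p k" and I: "lie_ideal s1 s2 k I" "locally_solvable s1 s2 I"
    and J: "lie_ideal s1 s2 k J" "locally_solvable s1 s2 J"
  shows "locally_solvable s1 s2 {x + z | x z. x \<in> I \<and> z \<in> J}"
  unfolding locally_solvable_def
proof (intro allI impI)
  fix X assume X: "finite X \<and> X \<subseteq> {x + z | x z. x \<in> I \<and> z \<in> J}"
  hence "\<forall>x\<in>X. \<exists>i j. x = i + j \<and> i \<in> I \<and> j \<in> J" by blast
  then obtain i j where ij: "\<And>x. x \<in> X \<Longrightarrow> x = i x + j x \<and> i x \<in> I \<and> j x \<in> J" by metis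
  let ?Y = "i ` X \<union> j ` X"
  have Y: "finite ?Y" "?Y \<subseteq> k"
  proof -
    show "finite ?Y" using X by simp
    have "i x \<in> k" "j x \<in> k" if "x \<in> X" for x
      using ij[OF that] lie_idealD(1)[OF k I(1)] lie_idealD(1)[OF k J(1)] by simp_all
    thus "?Y \<subseteq> k" by blast
  qed
  let ?L = "gen_subalg s1 s2 ?Y"
  have "?Y \<subseteq> gl" using Y(2) k by (auto simp: gl_subalgebra_def)
  hence L: "gl_subalgebra s1 s2 p ?L" by (rule gen_subalg_subalgebra)
  note I' = ideal_Int_gen_subalg[OF k I Y] and J' = ideal_Int_gen_subalg[OF k J Y]
  let ?M = "{x + z | x z. x \<in> ?L \<inter> I \<and> z \<in> ?L \<inter> J}"
  have "x \<in> ?M" if "x \<in> X" for x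
  proof -
    have "i x \<in> ?L \<inter> I" "j x \<in> ?L \<inter> J" using ij[OF that] gen_subalg_superset[of ?Y s1 s2] that by auto
    hence "i x + j x \<in> ?M" by (rule set_plus_memI)
    thus ?thesis using ij[OF that] by simp
  qed
  moreover have "lie_closed s1 s2 ?M"
    by (rule lie_closed_lie_ideal[OF ideal_plus[OF L I'(2) J'(2)]])
  ultimately have "gen_subalg s1 s2 X \<subseteq> ?M" by (intro gen_subalg_least) auto
  thus "lie_solvable s1 s2 (gen_subalg s1 s2 X)"
    by (rule lie_solvable_mono[OF solvable_plus[OF L I'(2,3) J'(2,3)]])
qed

text \<open>Justifies the definite description. Sums make the family of locally solvable ideals
  directed, so its union is an ideal, and a finite subset of the union lies in a single
  member.\<close>

lemma ls_radical_props:
  assumes k: "gl_subalgebra s1 s2 p k"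
  shows "lie_ideal s1 s2 k (ls_radical s1 s2 k)" "locally_solvable s1 s2 (ls_radical s1 s2 k)"
    "\<And>I. lie_ideal s1 s2 k I \<Longrightarrow> locally_solvable s1 s2 I \<Longrightarrow> I \<subseteq> ls_radical s1 s2 k"
proof -
  define Q where "Q = (\<lambda>I. lie_ideal s1 s2 k I \<and> locally_solvable s1 s2 I)"
  define R where "R = \<Union>{I. Q I}"
  have zero: "Q {0}"
  proof -
    have "G.subspace {0}" by simp
    hence "lie_ideal s1 s2 k {0}" using subalgebra_gl[OF k] G.subspace_0[OF subalgebra_subspace[OF k]]
      by (auto simp: lie_ideal_def gl_subspace_iff gl_br_zero_right)
    moreover have "lie_closed s1 s2 {0}"
      by (auto simp: lie_closed_def gl_subspace_iff gl_br_zero_right[OF G.subspace_0[OF gl_subspace_gl]])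
    hence "gen_subalg s1 s2 X \<subseteq> {0}" if "X \<subseteq> {0}" for X using that by (rule gen_subalg_least)
    hence "locally_solvable s1 s2 {0}" unfolding locally_solvable_def lie_solvable_def
      by (intro allI impI exI[of _ 0]) (simp add: gl_zero_eq_zero)
    ultimately show ?thesis by (simp add: Q_def)
  qed
  have plus: "Q {x + z | x z. x \<in> I \<and> z \<in> J}" if "Q I" "Q J" for I J
    using that ideal_plus[OF k] locally_solvable_plus[OF k] by (simp add: Q_def)
  have Q0: "0 \<in> I" if "Q I" for I
    using that lie_idealD(2)[OF k, of I] G.subspace_0 by (simp add: Q_def)
  have "x + z \<in> R" if xz: "x \<in> R" "z \<in> R" for x z
  proof -
    obtain I J where "Q I" "x \<in> I" "Q J" "z \<in> J" using xz by (auto simp: R_def)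
    thus ?thesis using plus[of I J] unfolding R_def by blast
  qed
  moreover have "gl_smul s1 s2 c x \<in> R" if x: "x \<in> R" for c x
  proof -
    obtain I where "Q I" "x \<in> I" using x by (auto simp: R_def)
    moreover from this have "gl_smul s1 s2 c x \<in> I"
      using lie_idealD(2)[OF k, of I] G.subspace_scale by (simp add: Q_def)
    ultimately show ?thesis by (auto simp: R_def)
  qed
  moreover have "0 \<in> R" using zero by (auto simp: R_def)
  ultimately have "G.subspace R" by (intro G.subspaceI)
  moreover have "R \<subseteq> k" by (auto simp: R_def Q_def lie_ideal_def)
  moreover have "gl_br x z \<in> R" if x: "x \<in> k" and z: "z \<in> R" for x z
  proof -
    obtain I where "Q I" "z \<in> I" using z by (auto simp: R_def)
    moreover from this have "gl_br x z \<in> I" using lie_idealD(3)[OF k, of I] x by (simp add: Q_def)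
    ultimately show ?thesis by (auto simp: R_def)
  qed
  ultimately have idl: "lie_ideal s1 s2 k R" by (simp add: lie_ideal_def gl_subspace_iff)
  have dir: "\<exists>I. Q I \<and> X \<subseteq> I" if "finite X" "X \<subseteq> R" for X
    using that
  proof (induction X)
    case empty thus ?case using zero by blast
  next
    case (insert x X)
    then obtain I J where IJ: "Q I" "X \<subseteq> I" "Q J" "x \<in> J" by (auto simp: R_def)
    let ?S = "{x + z | x z. x \<in> I \<and> z \<in> J}"
    have "y \<in> ?S" if "y \<in> I" for y using set_plus_memI[OF that Q0[OF IJ(3)]] by simp
    moreover have "x \<in> ?S" using set_plus_memI[OF Q0[OF IJ(1)] IJ(4)] by simp
    ultimately have "insert x X \<subseteq> ?S" using IJ(2) by blast
    thus ?case using plus[OF IJ(1,3)] by blast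
  qed
  have ls: "locally_solvable s1 s2 R"
    unfolding locally_solvable_def
  proof (intro allI impI)
    fix X assume X: "finite X \<and> X \<subseteq> R"
    then obtain I where "Q I" "X \<subseteq> I" using dir by blast
    thus "lie_solvable s1 s2 (gen_subalg s1 s2 X)" using X by (auto simp: Q_def locally_solvable_def)
  qed
  have mx: "I \<subseteq> R" if "lie_ideal s1 s2 k I" "locally_solvable s1 s2 I" for I
    using that by (auto simp: R_def Q_def)
  have "ls_radical s1 s2 k = R"
    unfolding ls_radical_def
  proof (rule the_equality)
    show "lie_ideal s1 s2 k R \<and> locally_solvable s1 s2 R \<and>
        (\<forall>I. lie_ideal s1 s2 k I \<and> locally_solvable s1 s2 I \<longrightarrow> I \<subseteq> R)"
      using idl ls mx by blast
  next
    fix R' assume R': "lie_ideal s1 s2 k R' \<and> locally_solvable s1 s2 R' \<and>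
        (\<forall>I. lie_ideal s1 s2 k I \<and> locally_solvable s1 s2 I \<longrightarrow> I \<subseteq> R')"
    show "R' = R" by (rule subset_antisym) (use R' idl ls mx in blast)+
  qed
  thus "lie_ideal s1 s2 k (ls_radical s1 s2 k)" "locally_solvable s1 s2 (ls_radical s1 s2 k)"
    "\<And>I. lie_ideal s1 s2 k I \<Longrightarrow> locally_solvable s1 s2 I \<Longrightarrow> I \<subseteq> ls_radical s1 s2 k"
    using idl ls mx by simp_all
qed

end

section \<open>The linear nilradical in terms of a flag\<close>

context vector_space
begin

text \<open>A linear projection modulo \<open>A\<close> replaces the quotient by \<open>A\<close>.\<close>

lemma quotient_map_exists:
  assumes A: "subspace A"
  obtains \<pi> where "Vector_Spaces.linear scale scale \<pi>" "\<And>u. \<pi> u = 0 \<longleftrightarrow> u \<in> A" "\<And>u. \<pi> u - u \<in> A"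
proof -
  have "Vector_Spaces.linear scale scale (\<lambda>x. x)" by (rule linear_ident)
  then obtain g where g: "g ` UNIV \<subseteq> A" "Vector_Spaces.linear scale scale g" "\<forall>v\<in>A. g v = v"
    using vector_space_pair.linear_exists_left_inverse_on[of scale scale "\<lambda>x. x" A] A
    by (auto simp: vector_space_pair_def vector_space_axioms)
  have "Vector_Spaces.linear scale scale (\<lambda>u. u - g u)"
    using g(2) unfolding Vector_Spaces.linear_iff
    by (simp add: scale_right_diff_distrib)
  moreover have "u - g u = 0 \<longleftrightarrow> u \<in> A" for u
    using g(1,3) by (metis UNIV_I eq_iff_diff_eq_0 image_subset_iff)
  moreover have "u - g u - u \<in> A" for u using g(1) subspace_neg[OF A, of "g u"] by auto
  ultimately show thesis by (rule that)
qed

end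

section \<open>Nilpotent elements of the radical on an irreducible quotient\<close>

context dual_pair
begin

text \<open>Induction on the derived length. The derived ideal acts by scalars, which vanish on
  commutators by \<open>scalar_commutator_zero\<close>; hence \<open>J\<close> acts by commuting
  operators and the commutative case applies.\<close>

lemma solvable_ideal_acts_by_scalars:
  assumes L: "gl_subalgebra s1 s2 p L" and act: "irreducible_action s1 L gl_br act B E"
    and act0: "\<And>u. act gl_zero u = 0"
    and J: "lie_ideal s1 s2 L J" "(der ^^ n) J \<subseteq> {gl_zero}"
  shows "\<exists>\<mu>. \<forall>y\<in>J. \<forall>u\<in>B. act y u = s1 (\<mu> y) u"
  using J
proof (induction n arbitrary: J)
  case 0
  have "act y u = s1 0 u" if "y \<in> J" for y u
    using that 0(2) act0 by (metis V.scale_zero_left empty_iff funpow_0 insert_iff subsetD)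
  thus ?case by (intro exI[of _ "\<lambda>_. 0"]) blast
next
  case (Suc n)
  interpret irreducible_action s1 L gl_br act B E by (rule act)
  note J' = lie_idealD[OF L Suc.prems(1)]
  have "(der ^^ n) (der J) \<subseteq> {gl_zero}" using Suc.prems(2) by (simp add: funpow_swap1)
  then obtain \<mu> where mu: "\<forall>y\<in>der J. \<forall>u\<in>B. act y u = s1 (\<mu> y) u"
    using Suc.IH[OF derived_ideal[OF L Suc.prems(1)]] by blast
  have comm: "act a (act b u) = act b (act a u)" if ab: "a \<in> J" "b \<in> J" and u: "u \<in> B" for a b u
  proof -
    have "act (gl_br a b) u = 0"
      by (rule scalar_commutator_zero[of a b "\<mu> (gl_br a b)"]) (use ab u mu derivedI J'(1) in auto)
    thus ?thesis using act_br[of a b u] ab J'(1) by simp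
  qed
  show ?case by (rule commuting_ideal_acts_by_scalars) (use J' comm in auto)
qed

text \<open>Let \<open>P\<close> be a minimal finite-dimensional \<open>?L\<close>-module meeting
  the coset of \<open>q\<close> modulo \<open>A\<close>, and \<open>P'\<close> a maximal proper
  submodule of \<open>P\<close>. By Lie's theorem \<open>x\<close> acts on \<open>P/P'\<close> by a
  scalar, which is 0 by nilpotency. So \<open>x q\<close> lies in \<open>A + P'\<close>, and so does
  \<open>q\<close>, which is generated from it; then \<open>P'\<close> meets the coset of
  \<open>q\<close>, against minimality of \<open>P\<close>.\<close>

lemma nilpotent_radical_strict:
  assumes k: "gl_subalgebra s1 s2 p k" and R: "lie_ideal s1 s2 k R" "locally_solvable s1 s2 R"
    and x: "x \<in> R" "(fst x ^^ n) = (\<lambda>_. 0)"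
    and irr: "irred_quot s1 fst k A B"
  shows "fst x ` B \<subseteq> A"
proof (rule ccontr)
  assume "\<not> fst x ` B \<subseteq> A"
  then obtain q where q: "q \<in> B" "fst x q \<notin> A" by blast
  from irr have sA: "V.subspace A" and sB: "V.subspace B" and AB: "A \<subset> B"
    and stA: "\<And>y u. y \<in> k \<Longrightarrow> u \<in> A \<Longrightarrow> fst y u \<in> A" and stB: "\<And>y u. y \<in> k \<Longrightarrow> u \<in> B \<Longrightarrow> fst y u \<in> B"
    and irr': "\<And>M. V.subspace M \<Longrightarrow> A \<subseteq> M \<Longrightarrow> M \<subseteq> B \<Longrightarrow> (\<And>y. y \<in> k \<Longrightarrow> fst y ` M \<subseteq> M) \<Longrightarrow> M = A \<or> M = B"
    unfolding irred_quot_def by (simp_all add: image_subset_iff)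
  have xk: "x \<in> k" using lie_idealD(1)[OF k R(1)] x(1) .
  have kgl: "\<And>y. y \<in> k \<Longrightarrow> y \<in> gl" using subalgebra_gl[OF k] .
  text \<open>By irreducibility \<open>q\<close> is generated from \<open>x q\<close> modulo \<open>A\<close>, and finitely many
    elements of \<open>k\<close> suffice for that.\<close>
  define gen where "gen = (\<lambda>X :: ('v, 'w) glel set. \<Inter>{M. V.subspace M \<and> A \<subseteq> M \<and> fst x q \<in> M \<and> (\<forall>y\<in>X. fst y ` M \<subseteq> M)})"
  have gen_mono: "X \<subseteq> Y \<Longrightarrow> gen X \<subseteq> gen Y" for X Y
    unfolding gen_def by (rule Inter_anti_mono) blast
  have gen_sub: "V.subspace (gen X)" for X unfolding gen_def by (rule V.subspace_Inter) simp
  have gen_A: "A \<subseteq> gen X" "fst x q \<in> gen X" for X unfolding gen_def by auto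
  have gen_st: "fst y u \<in> gen X" if "y \<in> X" "u \<in> gen X" for X y u
    using that unfolding gen_def by blast
  have gen_min: "gen X \<subseteq> M" if "V.subspace M" "A \<subseteq> M" "fst x q \<in> M" "\<And>y. y \<in> X \<Longrightarrow> fst y ` M \<subseteq> M" for X M
    unfolding gen_def using that by (intro Inter_lower) simp
  define U where "U = \<Union>(gen ` {X. finite X \<and> X \<subseteq> k})"
  have UI: "u \<in> U" if "finite X" "X \<subseteq> k" "u \<in> gen X" for X u using that by (auto simp: U_def)
  have UE: "\<exists>X. finite X \<and> X \<subseteq> k \<and> u \<in> gen X" if "u \<in> U" for u using that by (auto simp: U_def)
  have "V.subspace U"
  proof (rule V.subspaceI)
    show "0 \<in> U" by (rule UI[of "{}"]) (use V.subspace_0[OF gen_sub] in auto)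
  next
    fix u w assume "u \<in> U" "w \<in> U"
    then obtain X Y where XY: "finite X" "X \<subseteq> k" "u \<in> gen X" "finite Y" "Y \<subseteq> k" "w \<in> gen Y"
      using UE by metis
    have "u \<in> gen (X \<union> Y)" "w \<in> gen (X \<union> Y)"
      using gen_mono[of X "X \<union> Y"] gen_mono[of Y "X \<union> Y"] XY(3,6) by auto
    hence "u + w \<in> gen (X \<union> Y)" by (rule V.subspace_add[OF gen_sub])
    thus "u + w \<in> U" using XY by (intro UI[of "X \<union> Y"]) auto
  next
    fix c u assume "u \<in> U"
    then obtain X where X: "finite X" "X \<subseteq> k" "u \<in> gen X" using UE by metis
    thus "s1 c u \<in> U" using V.subspace_scale[OF gen_sub] by (intro UI[of X]) auto
  qed
  moreover have "A \<subseteq> U" using gen_A(1)[of "{}"] UI[of "{}"] by blast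
  moreover have "U \<subseteq> B"
  proof
    fix u assume "u \<in> U"
    then obtain X where X: "X \<subseteq> k" "u \<in> gen X" using UE by metis
    have "gen X \<subseteq> B" by (rule gen_min) (use sB AB stB xk q(1) X(1) in auto)
    thus "u \<in> B" using X(2) by blast
  qed
  moreover have "fst y ` U \<subseteq> U" if y: "y \<in> k" for y
  proof clarify
    fix u assume "u \<in> U"
    then obtain X where X: "finite X" "X \<subseteq> k" "u \<in> gen X" using UE by metis
    have "u \<in> gen (insert y X)" using gen_mono[of X "insert y X"] X(3) by blast
    hence "fst y u \<in> gen (insert y X)" by (rule gen_st[rotated]) simp
    thus "fst y u \<in> U" using X y by (intro UI[of "insert y X"]) auto
  qed
  moreover have "fst x q \<in> U" by (rule UI[of "{}"]) (use gen_A(2) in auto)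
  ultimately have "U = B" using irr'[of U] q(2) by blast
  then obtain X where X: "finite X" "X \<subseteq> k" "q \<in> gen X" using UE q(1) by metis
  let ?X = "insert x X"
  let ?L = "gen_subalg s1 s2 ?X"
  have fX: "finite ?X" and Xk: "?X \<subseteq> k" using X xk by auto
  have Xgl: "?X \<subseteq> gl" using Xk kgl by blast
  have L: "gl_subalgebra s1 s2 p ?L" by (rule gen_subalg_subalgebra[OF Xgl])
  note LR = ideal_Int_gen_subalg[OF k R fX Xk]
  have XL: "?X \<subseteq> ?L" by (rule gen_subalg_superset)
  have Lk: "y \<in> k" if "y \<in> ?L" for y using that LR(1) by blast
  have Llin: "Vector_Spaces.linear s1 s1 (fst y)" if "y \<in> ?L" for y
    using gl_linear_fst[OF kgl[OF Lk[OF that]]] .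
  obtain E0 where E0: "finite E0" "\<forall>y\<in>?L. \<forall>u. fst y u \<in> V.span E0"
    using gen_subalg_fin_image[OF fX Xgl] by blast
  \<comment> \<open>All of \<open>?L\<close> maps into \<open>V.span E0\<close>, so the span of
    \<open>?E\<close> is a module containing \<open>q\<close>; it starts the search for a minimal
    \<open>P\<close>.\<close>
  let ?E = "insert q E0"
  define Q where "Q = (\<lambda>P. V.subspace P \<and> P \<subseteq> V.span ?E \<and> (\<forall>y\<in>?L. fst y ` P \<subseteq> P) \<and> (\<exists>a\<in>A. q - a \<in> P))"
  have "Q (V.span ?E)"
  proof -
    have "V.span E0 \<subseteq> V.span ?E" by (rule V.span_mono) blast
    moreover have "q - 0 \<in> V.span ?E" using V.span_base[of q ?E] by simp
    ultimately show ?thesis using E0(2) V.subspace_0[OF sA] unfolding Q_def by blast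
  qed
  moreover have "V.subspace P \<and> P \<subseteq> V.span ?E" if "Q P" for P using that by (simp add: Q_def)
  moreover have finE: "finite ?E" using E0(1) by simp
  ultimately have "\<exists>P. Q P \<and> (\<forall>P'. Q P' \<longrightarrow> P' \<subseteq> P \<longrightarrow> P' = P)" by (rule V.minimal_subspace_exists)
  then obtain P where QP: "Q P" and Pmin: "\<And>P'. Q P' \<Longrightarrow> P' \<subseteq> P \<Longrightarrow> P' = P" by blast
  from QP have sP: "V.subspace P" and PE: "P \<subseteq> V.span ?E" and stP: "\<And>y. y \<in> ?L \<Longrightarrow> fst y ` P \<subseteq> P"
    and qP: "\<exists>a\<in>A. q - a \<in> P" by (simp_all add: Q_def)
  have P0: "P \<noteq> {0}"
  proof
    assume "P = {0}"
    hence "q \<in> A" using qP by auto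
    thus False using stA[OF xk] q(2) by blast
  qed
  define Q' where "Q' = (\<lambda>P'. V.subspace P' \<and> P' \<subset> P \<and> (\<forall>y\<in>?L. fst y ` P' \<subseteq> P'))"
  have "Q' {0}" using P0 V.subspace_0[OF sP] lin_zero[OF Llin] by (auto simp: Q'_def)
  moreover have "V.subspace P' \<and> P' \<subseteq> V.span ?E" if "Q' P'" for P' using that PE by (auto simp: Q'_def)
  ultimately have "\<exists>P'. Q' P' \<and> (\<forall>P''. Q' P'' \<longrightarrow> P' \<subseteq> P'' \<longrightarrow> P'' = P')"
    using finE by (rule V.maximal_subspace_exists)
  then obtain P' where QP': "Q' P'" and Pmax: "\<And>P''. Q' P'' \<Longrightarrow> P' \<subseteq> P'' \<Longrightarrow> P'' = P'" by blast
  from QP' have sP': "V.subspace P'" and PP': "P' \<subset> P" and stP': "\<And>y. y \<in> ?L \<Longrightarrow> fst y ` P' \<subseteq> P'"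
    by (simp_all add: Q'_def)
  obtain \<pi> where pi: "Vector_Spaces.linear s1 s1 \<pi>" "\<And>u. \<pi> u = 0 \<longleftrightarrow> u \<in> P'" "\<And>u. \<pi> u - u \<in> P'"
    using V.quotient_map_exists[OF sP'] by metis
  \<comment> \<open>The quotient of \<open>P\<close> by \<open>P'\<close> is realized as the image
    of \<open>P\<close> under the projection; \<open>pi_pi\<close> makes the projected operators an
    action.\<close>
  define act where "act = (\<lambda>(y :: ('v, 'w) glel) u. \<pi> (fst y u))"
  have pi_eq: "\<pi> u = \<pi> w" if "u - w \<in> P'" for u w
    using that pi(2)[of "u - w"] lin_diff[OF pi(1), of u w] by simp
  have pi_pi: "\<pi> (fst y (\<pi> u)) = \<pi> (fst y u)" if y: "y \<in> ?L" for y u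
  proof (rule pi_eq)
    show "fst y (\<pi> u) - fst y u \<in> P'"
      using pi(3)[of u] stP'[OF y] by (auto simp: lin_diff[OF Llin[OF y], symmetric])
  qed
  have pi_P: "\<pi> u \<in> P" if "u \<in> P" for u
    using V.subspace_add[OF sP, of "\<pi> u - u" u] pi(3)[of u] PP' that by auto
  have act: "irreducible_action s1 ?L gl_br act (\<pi> ` P) ?E"
  proof (intro irreducible_action.intro irreducible_action_axioms.intro)
    show "complex_space s1" by (rule V.complex_space_axioms)
    show "Vector_Spaces.linear s1 s1 (act y)" if "y \<in> ?L" for y
      using Vector_Spaces.linear_compose[OF Llin[OF that] pi(1)] by (simp add: act_def o_def)
    show "act (gl_br y z) u = act y (act z u) - act z (act y u)" if "y \<in> ?L" "z \<in> ?L" for y z u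
      using that by (simp add: act_def lin_diff[OF pi(1)] pi_pi)
    show "gl_br y z \<in> ?L" if "y \<in> ?L" "z \<in> ?L" for y z using subalgebra_br[OF L that] .
    show "act y ` \<pi> ` P \<subseteq> \<pi> ` P" if "y \<in> ?L" for y
      using pi_pi[OF that] stP[OF that] by (auto simp: act_def)
    show "V.subspace (\<pi> ` P)" by (rule module_hom.subspace_image[OF module_hom_linearI[OF pi(1)] sP])
    show "\<pi> ` P \<noteq> {0}"
    proof
      assume "\<pi> ` P = {0}"
      hence "u \<in> P'" if "u \<in> P" for u using that pi(2)[of u] by blast
      thus False using PP' by blast
    qed
    show "\<pi> ` P \<subseteq> V.span ?E" using pi_P PE by blast
    show "finite ?E" by (rule finE)
    fix M assume M: "V.subspace M" "M \<subseteq> \<pi> ` P" "\<And>y. y \<in> ?L \<Longrightarrow> act y ` M \<subseteq> M"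
    \<comment> \<open>The preimage of \<open>M\<close> in \<open>P\<close>, to be compared with the
      maximal \<open>P'\<close>.\<close>
    define N where "N = {u \<in> P. \<pi> u \<in> M}"
    have "V.subspace N"
      using sP M(1) unfolding N_def V.subspace_def by (simp add: lin_add[OF pi(1)] lin_scale[OF pi(1)] lin_zero[OF pi(1)])
    moreover have P'N: "P' \<subseteq> N" using PP' V.subspace_0[OF M(1)] by (auto simp: N_def pi(2)[THEN iffD2])
    moreover have "fst y ` N \<subseteq> N" if y: "y \<in> ?L" for y
    proof clarify
      fix u assume u: "u \<in> N"
      have "act y (\<pi> u) \<in> M" using M(3)[OF y] u by (auto simp: N_def)
      thus "fst y u \<in> N" using u stP[OF y] pi_pi[OF y, of u] by (auto simp: N_def act_def)
    qed
    moreover have "N \<subseteq> P" by (auto simp: N_def)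
    ultimately have "Q' N \<or> N = P" unfolding Q'_def by blast
    hence "N = P' \<or> N = P" using Pmax P'N by blast
    thus "M = {0} \<or> M = \<pi> ` P"
    proof
      assume "N = P'"
      hence "m = 0" if "m \<in> M" for m using that M(2) pi(2) by (force simp: N_def)
      thus ?thesis using V.subspace_0[OF M(1)] by blast
    next
      assume "N = P"
      thus ?thesis using M(2) by (auto simp: N_def)
    qed
  qed
  obtain m where m: "(der ^^ m) (?L \<inter> R) \<subseteq> {gl_zero}" using LR(3) unfolding lie_solvable_def ..
  have act0: "act gl_zero u = 0" for u by (simp add: act_def gl_zero_def lin_zero[OF pi(1)])
  obtain \<mu> where mu: "\<forall>y\<in>?L \<inter> R. \<forall>u\<in>\<pi> ` P. act y u = s1 (\<mu> y) u"
    using solvable_ideal_acts_by_scalars[OF L act act0 LR(2) m] by (elim exE)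
  have xLR: "x \<in> ?L \<inter> R" using XL x(1) by blast
  have xL: "x \<in> ?L" using xLR by blast
  have pi_x: "\<pi> (fst x u) = s1 (\<mu> x) (\<pi> u)" if "u \<in> P" for u
    using mu xLR that pi_pi[OF xL, of u] by (auto simp: act_def)
  have st: "(fst x ^^ i) u \<in> P" if "u \<in> P" for i u
    by (rule V.funpow_stable[OF stP[OF xL] that])
  have pow: "\<pi> ((fst x ^^ i) u) = s1 (\<mu> x ^ i) (\<pi> u)" if "u \<in> P" for i u
    by (induction i) (simp_all add: pi_x[OF st[OF that]])
  obtain u0 where u0: "u0 \<in> P" "u0 \<notin> P'" using PP' by blast
  have "s1 (\<mu> x ^ n) (\<pi> u0) = 0" using pow[OF u0(1), of n] x(2) lin_zero[OF pi(1)] by simp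
  hence "\<mu> x = 0" using pi(2)[of u0] u0(2) by simp
  hence xP: "fst x u \<in> P'" if "u \<in> P" for u using pi_x[OF that] pi(2) by simp
  obtain a where a: "a \<in> A" "q - a \<in> P" using qP by blast
  \<comment> \<open>It contains \<open>fst x q\<close>, since \<open>x\<close> preserves
    \<open>A\<close> and maps \<open>q - a\<close> into \<open>P'\<close>.\<close>
  let ?M = "{a + u | a u. a \<in> A \<and> u \<in> P'}"
  have "gen X \<subseteq> ?M"
  proof (rule gen_min)
    show "V.subspace ?M" by (rule V.subspace_sums[OF sA sP'])
    show "A \<subseteq> ?M"
    proof
      fix a assume "a \<in> A" thus "a \<in> ?M" using set_plus_memI[of a A 0 P'] V.subspace_0[OF sP'] by simp
    qed
    have "fst x q = fst x a + fst x (q - a)" by (simp add: lin_diff[OF Llin[OF xL]])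
    thus "fst x q \<in> ?M" using set_plus_memI[OF stA[OF xk a(1)] xP[OF a(2)]] by simp
    fix y assume y: "y \<in> X"
    have yL: "y \<in> ?L" and yk: "y \<in> k" using y XL X(2) by auto
    show "fst y ` ?M \<subseteq> ?M"
    proof clarify
      fix a u assume au: "a \<in> A" "u \<in> P'"
      have "fst y u \<in> P'" using stP'[OF yL] au(2) by blast
      hence "fst y a + fst y u \<in> ?M" by (rule set_plus_memI[OF stA[OF yk au(1)]])
      thus "\<exists>aa ua. fst y (a + u) = aa + ua \<and> aa \<in> A \<and> ua \<in> P'" by (simp add: lin_add[OF Llin[OF yL]])
    qed
  qed
  then obtain a' u' where au: "q = a' + u'" "a' \<in> A" "u' \<in> P'" using X(3) by blast
  have "Q P'"
    unfolding Q_def using sP' PP' PE stP' au by (auto intro!: bexI[of _ a'])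
  hence "P' = P" by (rule Pmin) (use PP' in blast)
  thus False using PP' by blast
qed

text \<open>Finite dimension replaces well-foundedness of the flag. Among the finitely many pairs
  attached to a basis of \<open>P\<close>, one with the largest successor \<open>B\<close> satisfies
  \<open>P \<subseteq> B\<close> but not \<open>P \<subseteq> A\<close>, so \<open>T\<close> maps
  \<open>P\<close> into the smaller space \<open>P \<inter> A\<close>. The principle serves both
  nilpotency and solvability.\<close>

lemma strictly_triangular_induct:
  assumes flag: "gen_flag s1 \<FF>" and T: "\<And>f A B. f \<in> T \<Longrightarrow> (A, B) \<in> flag_pairs \<FF> \<Longrightarrow> f ` B \<subseteq> A"
    and E: "finite E" "P \<subseteq> V.span E" and P: "V.subspace P" "stable_under T P"
    and base: "\<Phi> {0}"
    and step: "\<And>P P'. \<Phi> P' \<Longrightarrow> stable_under T P \<Longrightarrow> (\<And>f u. f \<in> T \<Longrightarrow> u \<in> P \<Longrightarrow> f u \<in> P') \<Longrightarrow> \<Phi> P"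
  shows "\<Phi> P"
  using E(2) P
proof (induction "V.dim P" arbitrary: P rule: less_induct)
  case less
  show ?case
  proof (cases "P = {0}")
    case False
    from flag have lin: "\<And>A B. A \<in> \<FF> \<Longrightarrow> B \<in> \<FF> \<Longrightarrow> A \<subseteq> B \<or> B \<subseteq> A"
      and sub: "\<And>A. A \<in> \<FF> \<Longrightarrow> V.subspace A"
      and vec: "\<And>v. v \<noteq> 0 \<Longrightarrow> \<exists>(A,B)\<in>flag_pairs \<FF>. v \<in> B \<and> v \<notin> A"
      unfolding gen_flag_def by simp_all
    obtain S where S: "S \<subseteq> P" "V.independent S" "P \<subseteq> V.span S" by (rule V.basis_exists[of P])
    have finS: "finite S"
      using V.independent_span_bound[OF E(1) S(2) order_trans[OF S(1) less.prems(1)]] ..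
    have "S \<noteq> {}" using S(3) False V.subspace_0[OF less.prems(2)] by auto
    have S0: "v \<noteq> 0" if "v \<in> S" for v using that S(2) V.dependent_zero by blast
    have "\<forall>v\<in>S. \<exists>AB\<in>flag_pairs \<FF>. v \<in> snd AB \<and> v \<notin> fst AB"
      using vec[OF S0] by (simp add: case_prod_beta)
    then obtain h where h: "\<And>v. v \<in> S \<Longrightarrow> h v \<in> flag_pairs \<FF> \<and> v \<in> snd (h v) \<and> v \<notin> fst (h v)" by metis
    have hF: "fst (h v) \<in> \<FF>" "snd (h v) \<in> \<FF>" if "v \<in> S" for v
      using h[OF that] by (auto simp: flag_pairs_def)
    obtain B where B: "B \<in> (\<lambda>v. snd (h v)) ` S" "\<forall>B'\<in>(\<lambda>v. snd (h v)) ` S. B \<subseteq> B' \<longrightarrow> B = B'"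
      using finite_has_maximal[of "(\<lambda>v. snd (h v)) ` S"] finS \<open>S \<noteq> {}\<close> by auto
    then obtain b where b: "b \<in> S" "B = snd (h b)" by blast
    let ?A = "fst (h b)"
    have pair: "(?A, B) \<in> flag_pairs \<FF>" using h[OF b(1)] b(2) by simp
    have "v \<in> B" if v: "v \<in> S" for v
    proof -
      have "snd (h v) \<subseteq> B" using lin[OF hF(2)[OF v] hF(2)[OF b(1)]] B(2) v b(2) by blast
      thus ?thesis using h[OF v] by blast
    qed
    hence PB: "P \<subseteq> B" using S(3) V.span_minimal[of S B] sub[OF hF(2)[OF b(1)]] b(2) by blast
    let ?P' = "P \<inter> ?A"
    have into: "f u \<in> ?P'" if "f \<in> T" "u \<in> P" for f u
      using T[OF that(1) pair] stableD[OF less.prems(3) that] that(2) PB by blast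
    have "b \<in> P" "b \<notin> ?A" using S(1) b(1) h[OF b(1)] by auto
    hence ps: "?P' \<subset> P" by blast
    have sP': "V.subspace ?P'" by (rule V.subspace_inter[OF less.prems(2) sub[OF hF(1)[OF b(1)]]])
    have "stable_under T ?P'" unfolding stable_under_def using into by blast
    moreover have "V.dim ?P' < V.dim P" by (rule V.dim_strict_mono[OF sP' ps less.prems(1) E(1)])
    moreover have "?P' \<subseteq> V.span E" using less.prems(1) by blast
    ultimately have "\<Phi> ?P'" using less.hyps sP' by blast
    thus ?thesis using less.prems(3) into by (rule step)
  qed (simp add: base)
qed

section \<open>The ideal of strictly triangular elements\<close>

definition strict_part :: "'v set set \<Rightarrow> ('v, 'w) glel set \<Rightarrow> ('v, 'w) glel set" where
  "strict_part \<FF> k = {x \<in> k. \<forall>(A, B)\<in>flag_pairs \<FF>. fst x ` B \<subseteq> A}"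

context
  fixes \<FF> k
  assumes flag: "gen_flag s1 \<FF>" and k: "gl_subalgebra s1 s2 p k" and stab: "k \<subseteq> StV s1 s2 p \<FF>"
begin

lemma strict_partD:
  "x \<in> strict_part \<FF> k \<Longrightarrow> (A, B) \<in> flag_pairs \<FF> \<Longrightarrow> u \<in> B \<Longrightarrow> fst x u \<in> A"
  unfolding strict_part_def by blast

lemma strict_part_subset: "strict_part \<FF> k \<subseteq> k"
  by (auto simp: strict_part_def)

lemma strict_part_ideal: "lie_ideal s1 s2 k (strict_part \<FF> k)"
proof -
  have sub: "V.subspace A" if "(A, B) \<in> flag_pairs \<FF>" for A B
    using flag that by (simp add: gen_flag_def flag_pairs_def)
  have st: "fst x u \<in> F" if "x \<in> k" "F \<in> \<FF>" "u \<in> F" for x u F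
    using stab that by (auto simp: StV_def)
  have "G.subspace (strict_part \<FF> k)"
  proof (rule G.subspaceI)
    show "0 \<in> strict_part \<FF> k"
      using G.subspace_0[OF subalgebra_subspace[OF k]] V.subspace_0[OF sub] by (auto simp: strict_part_def)
  next
    fix x z assume xz: "x \<in> strict_part \<FF> k" "z \<in> strict_part \<FF> k"
    hence "x + z \<in> k" using strict_part_subset G.subspace_add[OF subalgebra_subspace[OF k]] by blast
    moreover have "fst (x + z) u \<in> A" if "(A, B) \<in> flag_pairs \<FF>" "u \<in> B" for A B u
      using V.subspace_add[OF sub[OF that(1)] strict_partD[OF xz(1) that] strict_partD[OF xz(2) that]] by simp
    ultimately show "x + z \<in> strict_part \<FF> k" unfolding strict_part_def by blast
  next
    fix c x assume x: "x \<in> strict_part \<FF> k"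
    hence "gl_smul s1 s2 c x \<in> k" using strict_part_subset G.subspace_scale[OF subalgebra_subspace[OF k]] by blast
    moreover have "fst (gl_smul s1 s2 c x) u \<in> A" if "(A, B) \<in> flag_pairs \<FF>" "u \<in> B" for A B u
      using V.subspace_scale[OF sub[OF that(1)] strict_partD[OF x that]] by simp
    ultimately show "gl_smul s1 s2 c x \<in> strict_part \<FF> k" unfolding strict_part_def by blast
  qed
  moreover have "gl_br x z \<in> strict_part \<FF> k" if x: "x \<in> k" and z: "z \<in> strict_part \<FF> k" for x z
  proof -
    have "gl_br x z \<in> k" using subalgebra_br[OF k x] z strict_part_subset by blast
    moreover have "fst (gl_br x z) u \<in> A" if AB: "(A, B) \<in> flag_pairs \<FF>" and u: "u \<in> B" for A B u
    proof -
      have F: "A \<in> \<FF>" "B \<in> \<FF>" using AB by (auto simp: flag_pairs_def)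
      show ?thesis
        using V.subspace_diff[OF sub[OF AB] st[OF x F(1) strict_partD[OF z AB u]]
            strict_partD[OF z AB st[OF x F(2) u]]] by simp
    qed
    ultimately show ?thesis unfolding strict_part_def by blast
  qed
  ultimately show ?thesis
    unfolding lie_ideal_def gl_subspace_iff using strict_part_subset by blast
qed

lemma strict_part_nilpotent:
  assumes x: "x \<in> strict_part \<FF> k"
  shows "\<exists>n. (fst x ^^ n) = (\<lambda>_. 0)"
proof -
  have xgl: "x \<in> gl" using x strict_part_subset subalgebra_gl[OF k] by blast
  obtain E where E: "finite E" "\<forall>y\<in>gen_subalg s1 s2 {x}. \<forall>u. fst y u \<in> V.span E"
    using gen_subalg_fin_image[of "{x}"] xgl by auto
  hence im: "fst x u \<in> V.span E" for u using gen_subalg_superset[of "{x}" s1 s2] by blast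
  have "\<exists>n. \<forall>u\<in>V.span E. (fst x ^^ n) u = 0"
  proof (rule strictly_triangular_induct[OF flag, where T = "{fst x}" and E = E])
    show "f ` B \<subseteq> A" if "f \<in> {fst x}" "(A, B) \<in> flag_pairs \<FF>" for f A B
      using strict_partD[OF x that(2)] that(1) by auto
    show "stable_under {fst x} (V.span E)" using im by (auto simp: stable_under_def)
    show "\<exists>n. \<forall>u\<in>{0}. (fst x ^^ n) u = 0" by (intro exI[of _ 0]) simp
  next
    fix P P' assume "\<exists>n. \<forall>u\<in>P'. (fst x ^^ n) u = 0" and into: "\<And>f u. f \<in> {fst x} \<Longrightarrow> u \<in> P \<Longrightarrow> f u \<in> P'"
    then obtain n where "\<forall>u\<in>P'. (fst x ^^ n) u = 0" by blast
    hence "\<forall>u\<in>P. (fst x ^^ Suc n) u = 0" using into by (simp add: funpow_swap1)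
    thus "\<exists>n. \<forall>u\<in>P. (fst x ^^ n) u = 0" ..
  qed (use E(1) in simp_all)
  then obtain n where "\<forall>u\<in>V.span E. (fst x ^^ n) u = 0" by blast
  \<comment> \<open>One extra power carries all of \<open>V\<close> into
    \<open>V.span E\<close>.\<close>
  hence "(fst x ^^ Suc n) = (\<lambda>_. 0)" using im by (simp add: fun_eq_iff funpow_swap1)
  thus ?thesis ..
qed

lemma strict_part_locally_solvable: "locally_solvable s1 s2 (strict_part \<FF> k)"
  unfolding locally_solvable_def
proof (intro allI impI)
  fix X assume X: "finite X \<and> X \<subseteq> strict_part \<FF> k"
  let ?L = "gen_subalg s1 s2 X"
  have Xgl: "X \<subseteq> gl" using X strict_part_subset subalgebra_gl[OF k] by blast
  have LN: "?L \<subseteq> strict_part \<FF> k"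
    using X by (intro gen_subalg_least lie_closed_lie_ideal[OF strict_part_ideal]) simp
  have L: "gl_subalgebra s1 s2 p ?L" by (rule gen_subalg_subalgebra[OF Xgl])
  have Lid: "lie_ideal s1 s2 ?L ?L"
    using subalgebra_subspace[OF L] subalgebra_br[OF L] unfolding lie_ideal_def gl_subspace_iff by simp
  have Dn: "(der ^^ n) ?L \<subseteq> ?L" for n using derived_funpow_ideal[OF L Lid] by blast
  obtain E where E: "finite E" "\<forall>y\<in>?L. \<forall>u. fst y u \<in> V.span E"
    using gen_subalg_fin_image[of X] X Xgl by blast
  \<comment> \<open>Both terms of a bracket pass through \<open>P'\<close>, where the
    \<open>n\<close>-th derived algebra already vanishes.\<close>
  have kill_step: "\<forall>y\<in>(der ^^ Suc n) ?L. \<forall>u\<in>P. fst y u = 0"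
    if into: "\<And>y u. y \<in> ?L \<Longrightarrow> u \<in> P \<Longrightarrow> fst y u \<in> P'" and kill: "\<forall>y\<in>(der ^^ n) ?L. \<forall>u\<in>P'. fst y u = 0" for n P P'
  proof -
    have "der ((der ^^ n) ?L) \<subseteq> {y. \<forall>u\<in>P. fst y u = 0}"
    proof (rule derived_minimal)
      show "G.subspace {y. \<forall>u\<in>P. fst y u = 0}" by (auto simp: G.subspace_def)
      fix y z assume yz: "y \<in> (der ^^ n) ?L" "z \<in> (der ^^ n) ?L"
      have "fst y (fst z u) = 0" "fst z (fst y u) = 0" if "u \<in> P" for u
        using kill yz into[OF subsetD[OF Dn yz(1)] that] into[OF subsetD[OF Dn yz(2)] that] by simp_all
      thus "gl_br y z \<in> {y. \<forall>u\<in>P. fst y u = 0}" by simp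
    qed
    thus ?thesis by auto
  qed
  have "\<exists>n. \<forall>y\<in>(der ^^ n) ?L. \<forall>u\<in>V.span E. fst y u = 0"
  proof (rule strictly_triangular_induct[OF flag, where T = "fst ` ?L" and E = E])
    show "f ` B \<subseteq> A" if "f \<in> fst ` ?L" "(A, B) \<in> flag_pairs \<FF>" for f A B
      using strict_partD[OF _ that(2)] that(1) LN by auto
    show "stable_under (fst ` ?L) (V.span E)" using E(2) by (auto simp: stable_under_def)
    have "fst y 0 = 0" if "y \<in> ?L" for y by (rule lin_zero[OF gl_linear_fst[OF subalgebra_gl[OF L that]]])
    thus "\<exists>n. \<forall>y\<in>(der ^^ n) ?L. \<forall>u\<in>{0}. fst y u = 0" by (intro exI[of _ 0]) simp
  next
    fix P P' assume "\<exists>n. \<forall>y\<in>(der ^^ n) ?L. \<forall>u\<in>P'. fst y u = 0"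
      and into: "\<And>f u. f \<in> fst ` ?L \<Longrightarrow> u \<in> P \<Longrightarrow> f u \<in> P'"
    then obtain n where n: "\<forall>y\<in>(der ^^ n) ?L. \<forall>u\<in>P'. fst y u = 0" by blast
    have "\<forall>y\<in>(der ^^ Suc n) ?L. \<forall>u\<in>P. fst y u = 0"
      by (rule kill_step[OF _ n]) (use into in blast)
    thus "\<exists>n. \<forall>y\<in>(der ^^ n) ?L. \<forall>u\<in>P. fst y u = 0" ..
  qed (use E(1) in simp_all)
  then obtain n where n: "\<forall>y\<in>(der ^^ n) ?L. \<forall>u\<in>V.span E. fst y u = 0" by blast
  \<comment> \<open>The extra step takes \<open>UNIV\<close> for \<open>P\<close>, since all images
    lie in \<open>V.span E\<close>.\<close>
  have n': "\<forall>y\<in>(der ^^ Suc n) ?L. \<forall>u\<in>UNIV. fst y u = 0"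
    by (rule kill_step[OF _ n]) (use E(2) in blast)
  have "y = gl_zero" if y: "y \<in> (der ^^ Suc n) ?L" for y
    by (rule gl_eq_zeroI[OF subalgebra_gl[OF L subsetD[OF Dn y]]]) (use n' y in blast)
  hence "(der ^^ Suc n) ?L \<subseteq> {gl_zero}" by blast
  thus "lie_solvable s1 s2 ?L" unfolding lie_solvable_def ..
qed

text \<open>Strictness of the nilradical comes from \<open>nilpotent_radical_strict\<close> at
  closed predecessors and from \<open>fin_op_closure\<close> at the others.\<close>

lemma lin_nilrad_eq_strict_part:
  assumes semi: "semiclosedV p \<FF>"
    and irr: "\<And>A B. (A, B) \<in> flag_pairs \<FF> \<Longrightarrow> closedV p A \<Longrightarrow> irred_quot s1 fst k A B"
  shows "lin_nilrad s1 s2 k = strict_part \<FF> k"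
proof (rule subset_antisym)
  note R = ls_radical_props[OF k]
  show "strict_part \<FF> k \<subseteq> lin_nilrad s1 s2 k"
    using R(3)[OF strict_part_ideal strict_part_locally_solvable] strict_part_nilpotent
    unfolding lin_nilrad_def by blast
  show "lin_nilrad s1 s2 k \<subseteq> strict_part \<FF> k"
  proof
    fix x assume "x \<in> lin_nilrad s1 s2 k"
    then obtain n where x: "x \<in> ls_radical s1 s2 k" "(fst x ^^ n) = (\<lambda>_. 0)"
      unfolding lin_nilrad_def by blast
    have xk: "x \<in> k" using lie_idealD(1)[OF k R(1) x(1)] .
    have "fst x ` B \<subseteq> A" if AB: "(A, B) \<in> flag_pairs \<FF>" for A B
    proof (cases "closedV p A")
      case True
      show ?thesis by (rule nilpotent_radical_strict[OF k R(1,2) x irr[OF AB True]])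
    next
      case False
      have A: "A \<in> \<FF>" using AB by (auto simp: flag_pairs_def)
      have "closureV p A = A \<or> closureV p A = B" using semi AB unfolding semiclosedV_def by blast
      hence cl: "closureV p A = B" using False by (auto simp: closedV_def)
      have "fst x ` A \<subseteq> A" using stab xk A by (auto simp: StV_def)
      moreover have "V.subspace A" using flag A by (simp add: gen_flag_def)
      ultimately show ?thesis using fin_op_closure[OF gl_fin_op[OF subalgebra_gl[OF k xk]], of A A] cl by simp
    qed
    thus "x \<in> strict_part \<FF> k" using xk unfolding strict_part_def by blast
  qed
qed

end

end

section \<open>The taut couple\<close>

context dual_pair
begin

lemma perpW_perpV_closed: "closedV p X \<Longrightarrow> perpW p (perpV p X) = X"
  by (simp add: closedV_def closureV_def)

lemma closedW_perpV: "closedW p (perpV p X)"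
  using perpV_closureV[of X] by (simp add: closedW_def closureW_def closureV_def)

lemma perp_stable:
  assumes "x \<in> gl" "fst x ` X \<subseteq> X"
  shows "snd x ` perpV p X \<subseteq> perpV p X"
proof clarify
  fix y assume y: "y \<in> perpV p X"
  show "snd x y \<in> perpV p X"
    unfolding perpV_def
  proof clarify
    fix u assume "u \<in> X"
    hence "p (fst x u) y = 0" using assms(2) y by (auto simp: perpV_def)
    thus "p u (snd x y) = 0" using gl_adjoint[OF assms(1)] by simp
  qed
qed

lemma perp_stable':
  assumes "x \<in> gl" "snd x ` Y \<subseteq> Y"
  shows "fst x ` perpW p Y \<subseteq> perpW p Y"
proof clarify
  fix u assume u: "u \<in> perpW p Y"
  show "fst x u \<in> perpW p Y"
    unfolding perpW_def
  proof clarify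
    fix y assume "y \<in> Y"
    hence "p u (snd x y) = 0" using assms(2) u by (auto simp: perpW_def)
    thus "p (fst x u) y = 0" using gl_adjoint[OF assms(1)] by simp
  qed
qed

end

section \<open>Exchanging the two sides of the pairing\<close>

lemma perpV_flip: "perpV (\<lambda>y u. p u y) = perpW p" and perpW_flip: "perpW (\<lambda>y u. p u y) = perpV p"
  by (simp_all add: perpV_def perpW_def fun_eq_iff)

lemma closureV_flip: "closureV (\<lambda>y u. p u y) Y = closureW p Y"
  unfolding closureV_def closureW_def perpV_flip[of p] perpW_flip[of p] ..

lemma closedV_flip: "closedV (\<lambda>y u. p u y) Y = closedW p Y"
  unfolding closedV_def closedW_def closureV_flip[of p] ..

lemma semiclosedV_flip: "semiclosedV (\<lambda>y u. p u y) \<GG> = semiclosedW p \<GG>"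
  unfolding semiclosedV_def semiclosedW_def closureV_flip[of p] ..

lemma irred_quot_image: "irred_quot s (\<lambda>f. f) (act ` k) A B \<longleftrightarrow> irred_quot s act k A B"
  by (simp add: irred_quot_def)

text \<open>A larger algebra has fewer submodules. This makes the flag of \<open>k\<close> usable
  for the stabilizer.\<close>

lemma irred_quot_mono:
  assumes irr: "irred_quot s act k A B" and kS: "k \<subseteq> S" and st: "\<forall>x\<in>S. act x ` A \<subseteq> A \<and> act x ` B \<subseteq> B"
  shows "irred_quot s act S A B"
proof -
  from irr have sub: "module.subspace s A" "module.subspace s B" "A \<subset> B"
    and max: "\<And>M. module.subspace s M \<Longrightarrow> A \<subseteq> M \<Longrightarrow> M \<subseteq> B \<Longrightarrow> \<forall>x\<in>k. act x ` M \<subseteq> M \<Longrightarrow> M = A \<or> M = B"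
    unfolding irred_quot_def by simp_all
  have "M = A \<or> M = B"
    if M: "module.subspace s M \<and> A \<subseteq> M \<and> M \<subseteq> B \<and> (\<forall>x\<in>S. act x ` M \<subseteq> M)" for M
    by (rule max) (use M kS subsetD[OF kS] in simp_all)
  thus ?thesis unfolding irred_quot_def using sub st by simp
qed

context dual_pair
begin

interpretation flip: dual_pair s2 s1 "\<lambda>y u. p u y" by (rule flip)

lemma closed_submodule_perpV:
  assumes k: "k \<subseteq> gl" and X: "closed_submodule (fst ` k) X"
  shows "flip.closed_submodule (snd ` k) (perpV p X)"
  unfolding flip.closed_submodule_def closedV_flip[of p]
proof (intro conjI subspace_perpV closedW_perpV)
  show "stable_under (snd ` k) (perpV p X)"
    using perp_stable[of _ X] X k unfolding closed_submodule_def stable_under_def by blast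
qed

lemma closed_submodule_perpW:
  assumes k: "k \<subseteq> gl" and Y: "flip.closed_submodule (snd ` k) Y"
  shows "closed_submodule (fst ` k) (perpW p Y)" and "perpV p (perpW p Y) = Y"
proof -
  have cl: "closedW p Y" using Y by (simp add: flip.closed_submodule_def closedV_flip[of p])
  show eq: "perpV p (perpW p Y) = Y" using cl by (simp add: closedW_def closureW_def)
  have "closedV p (perpW p Y)" by (simp add: closedV_def closureV_def eq)
  moreover have "stable_under (fst ` k) (perpW p Y)"
    using perp_stable'[of _ Y] Y k unfolding flip.closed_submodule_def stable_under_def by blast
  ultimately show "closed_submodule (fst ` k) (perpW p Y)"
    by (simp add: closed_submodule_def subspace_perpW)
qed

lemma fin_ops_fst: "k \<subseteq> gl \<Longrightarrow> \<forall>f\<in>fst ` k. fin_op f"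
  using gl_fin_op by blast

lemma fin_ops_snd: "k \<subseteq> gl \<Longrightarrow> \<forall>f\<in>snd ` k. flip.fin_op f"
  using gl_fin_op_snd by blast

text \<open>On closed submodules \<open>perpV\<close> and \<open>perpW\<close> are mutually inverse
  and reverse inclusion, so comparability with the whole chain, and with it maximality, is
  transported.\<close>

lemma max_closed_chain_perp:
  assumes k: "k \<subseteq> gl" and C: "max_closed_chain (fst ` k) \<C>"
  shows "flip.max_closed_chain (snd ` k) (perpV p ` \<C>)"
  unfolding flip.max_closed_chain_def
proof (intro conjI ballI allI impI)
  note fC = fin_ops_fst[OF k] C
  fix Y assume "Y \<in> perpV p ` \<C>"
  thus "flip.closed_submodule (snd ` k) Y" using closed_submodule_perpV[OF k] chain_closed[OF fC] by blast
next
  note fC = fin_ops_fst[OF k] C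
  fix Y Y' assume "Y \<in> perpV p ` \<C>" "Y' \<in> perpV p ` \<C>"
  then obtain X X' where X: "X \<in> \<C>" "Y = perpV p X" "X' \<in> \<C>" "Y' = perpV p X'" by blast
  show "Y \<subseteq> Y' \<or> Y' \<subseteq> Y"
    using chain_total[OF fC X(1,3)] perpV_antimono[of X X'] perpV_antimono[of X' X] X(2,4) by blast
next
  note fC = fin_ops_fst[OF k] C
  fix Y assume Y: "flip.closed_submodule (snd ` k) Y" and comp: "\<forall>Y'\<in>perpV p ` \<C>. Y \<subseteq> Y' \<or> Y' \<subseteq> Y"
  note Y' = closed_submodule_perpW[OF k Y]
  have "perpW p Y \<in> \<C>"
  proof (rule chain_max[OF fC Y'(1)])
    fix X assume X: "X \<in> \<C>"
    have "perpW p (perpV p X) = X"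
      using chain_closed[OF fC X] by (intro perpW_perpV_closed) (simp add: closed_submodule_def)
    moreover have "Y \<subseteq> perpV p X \<or> perpV p X \<subseteq> Y" using comp X by blast
    ultimately show "perpW p Y \<subseteq> X \<or> X \<subseteq> perpW p Y"
      using flip.perpV_antimono[of Y "perpV p X"] flip.perpV_antimono[of "perpV p X" Y]
      unfolding perpV_flip[of p] by auto
  qed
  thus "Y \<in> perpV p ` \<C>" using Y'(2) by (metis image_eqI)
qed

lemma taut_couple_exists:
  assumes k: "gl_subalgebra s1 s2 p k"
  shows "\<exists>\<FF> \<GG>. taut_couple s1 s2 p \<FF> \<GG> \<and>
           k \<subseteq> StV s1 s2 p \<FF> \<inter> StW s1 s2 p \<GG> \<and>
           (\<forall>((F1,F2),(G1,G2)) \<in> taut_C p \<FF> \<GG>.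
               irred_quot s1 fst k F1 F2 \<and> irred_quot s2 snd k G1 G2) \<and>
           lin_nilrad s1 s2 k = lin_nilrad s1 s2 (StV s1 s2 p \<FF> \<inter> StW s1 s2 p \<GG>) \<inter> k"
proof -
  have kgl: "k \<subseteq> gl" using k by (simp add: gl_subalgebra_def)
  obtain \<C> where C: "max_closed_chain (fst ` k) \<C>" using max_closed_chain_exists by blast
  let ?C' = "perpV p ` \<C>"
  have C': "flip.max_closed_chain (snd ` k) ?C'" by (rule max_closed_chain_perp[OF kgl C])
  note ops_fin = fin_ops_fst[OF kgl] and fin' = fin_ops_snd[OF kgl]
  define \<FF> where "\<FF> = flag_of (refine s1 (fst ` k) \<C>)"
  define \<GG> where "\<GG> = flag_of (refine s2 (snd ` k) ?C')"
  note F = flag_of_refine[of "fst ` k" \<C>, OF ops_fin C, folded \<FF>_def]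
  note G = flip.flag_of_refine[of "snd ` k" ?C', OF fin' C', folded \<GG>_def, unfolded semiclosedV_flip[of p] closedV_flip[of p]]
  have F_irr: "irred_quot s1 fst k A B" if "(A, B) \<in> flag_pairs \<FF>" "closedV p A" for A B
    using F(4)[OF that] by (simp add: irred_quot_image)
  have G_irr: "irred_quot s2 snd k A B" if "(A, B) \<in> flag_pairs \<GG>" "closedW p A" for A B
    using G(4)[OF that] by (simp add: irred_quot_image)
  have stF: "fst x ` X \<subseteq> X" if "x \<in> StV s1 s2 p \<FF>" "X \<in> \<C>" for x X
    by (rule flag_stable_imp_chain_stable[of "fst ` k" \<C>, OF ops_fin C, folded \<FF>_def])
      (use that lin_zero[OF gl_linear_fst] in \<open>auto simp: StV_def\<close>)
  have stG: "snd x ` Y \<subseteq> Y" if "x \<in> StW s1 s2 p \<GG>" "Y \<in> ?C'" for x Y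
    by (rule flip.flag_stable_imp_chain_stable[of "snd ` k" ?C', OF fin' C', folded \<GG>_def])
      (use that lin_zero[OF gl_linear_snd] in \<open>auto simp: StW_def\<close>)
  \<comment> \<open>A subspace and its closure have the same complement, and the closure of a flag
    member belongs to the chain.\<close>
  have perpF: "perpV p A \<in> ?C'" if "A \<in> \<FF>" for A
  proof -
    have "closureV p A \<in> \<C>"
      using closure_flag_in_chain[of "fst ` k" \<C>, OF ops_fin C, folded \<FF>_def] that by blast
    thus ?thesis using perpV_closureV[of A] by (metis image_eqI)
  qed
  have perpG: "perpW p Y \<in> \<C>" if "Y \<in> \<GG>" for Y
  proof -
    have "closureW p Y \<in> ?C'"
      using flip.closure_flag_in_chain[of "snd ` k" ?C', OF fin' C', folded \<GG>_def] that
      unfolding closureV_flip[of p] by blast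
    then obtain X where X: "X \<in> \<C>" "closureW p Y = perpV p X" by blast
    have "perpW p Y = perpW p (closureW p Y)"
      using flip.perpV_closureV[of Y] by (simp add: perpV_flip[of p] closureV_flip[of p])
    also have "\<dots> = X"
      unfolding X(2) using chain_closed[OF ops_fin C X(1)]
      by (intro perpW_perpV_closed) (simp add: closed_submodule_def)
    finally show ?thesis using X(1) by simp
  qed
  have taut: "taut_couple s1 s2 p \<FF> \<GG>"
    unfolding taut_couple_def
  proof (intro conjI ballI F(1,2) G(1,2))
    fix x A assume "x \<in> StW s1 s2 p \<GG>" "A \<in> \<FF>"
    thus "snd x ` perpV p A \<subseteq> perpV p A" by (intro stG perpF)
  next
    fix x Y assume "x \<in> StV s1 s2 p \<FF>" "Y \<in> \<GG>"
    thus "fst x ` perpW p Y \<subseteq> perpW p Y" by (intro stF perpG)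
  qed
  let ?S = "StV s1 s2 p \<FF> \<inter> StW s1 s2 p \<GG>"
  have kF: "k \<subseteq> StV s1 s2 p \<FF>" using F(3) kgl by (auto simp: StV_def stable_under_def)
  moreover have "k \<subseteq> StW s1 s2 p \<GG>" using G(3) kgl by (auto simp: StW_def stable_under_def)
  ultimately have kS: "k \<subseteq> ?S" by blast
  have S: "gl_subalgebra s1 s2 p ?S"
  proof -
    have subF: "V.subspace A" if "A \<in> \<FF>" for A using F(1) that by (simp add: gen_flag_def)
    have subG: "W.subspace A" if "A \<in> \<GG>" for A using G(1) that by (simp add: gen_flag_def)
    have iff: "x \<in> ?S \<longleftrightarrow> x \<in> gl \<and> (\<forall>A\<in>\<FF>. \<forall>u\<in>A. fst x u \<in> A) \<and> (\<forall>A\<in>\<GG>. \<forall>u\<in>A. snd x u \<in> A)" for x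
      unfolding StV_def StW_def image_subset_iff by blast
    have "G.subspace ?S"
      by (rule G.subspaceI; unfold iff)
        (simp_all add: G.subspace_0[OF gl_subspace_gl] G.subspace_add[OF gl_subspace_gl]
          G.subspace_scale[OF gl_subspace_gl] V.subspace_0[OF subF] W.subspace_0[OF subG]
          V.subspace_add[OF subF] W.subspace_add[OF subG] V.subspace_scale[OF subF] W.subspace_scale[OF subG])
    moreover have "gl_br x z \<in> ?S" if "x \<in> ?S" "z \<in> ?S" for x z
      using that unfolding iff
      by (simp add: gl_br_closed V.subspace_diff[OF subF] W.subspace_diff[OF subG])
    moreover have "?S \<subseteq> gl" by (auto simp: StV_def)
    ultimately show ?thesis by (simp add: gl_subalgebra_def lie_closed_def gl_subspace_iff)
  qed
  have S_irr: "irred_quot s1 fst ?S A B" if AB: "(A, B) \<in> flag_pairs \<FF>" "closedV p A" for A B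
  proof -
    have "A \<in> \<FF>" "B \<in> \<FF>" using AB(1) by (auto simp: flag_pairs_def)
    hence "\<forall>x\<in>?S. fst x ` A \<subseteq> A \<and> fst x ` B \<subseteq> B" by (simp add: StV_def)
    thus ?thesis by (rule irred_quot_mono[OF F_irr[OF AB] kS])
  qed
  have "lin_nilrad s1 s2 k = strict_part \<FF> k"
    by (rule lin_nilrad_eq_strict_part[OF F(1) k kF F(2) F_irr])
  also have "\<dots> = strict_part \<FF> ?S \<inter> k" using kS unfolding strict_part_def by blast
  also have "strict_part \<FF> ?S = lin_nilrad s1 s2 ?S"
    by (rule lin_nilrad_eq_strict_part[OF F(1) S Int_lower1 F(2) S_irr, symmetric])
  finally have "lin_nilrad s1 s2 k = lin_nilrad s1 s2 ?S \<inter> k" .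
  \<comment> \<open>An element of \<open>taut_C\<close> has closed predecessors on both sides, so
    each quotient is irreducible by its own flag.\<close>
  moreover have "\<forall>((F1,F2),(G1,G2)) \<in> taut_C p \<FF> \<GG>. irred_quot s1 fst k F1 F2 \<and> irred_quot s2 snd k G1 G2"
    unfolding taut_C_def by (auto intro!: F_irr G_irr)
  ultimately show ?thesis using taut kS by (intro exI[of _ \<FF>] exI[of _ \<GG>] conjI)
qed

end

theorem theorem3p7:
  fixes sV :: "complex \<Rightarrow> 'v::ab_group_add \<Rightarrow> 'v"
    and sW :: "complex \<Rightarrow> 'w::ab_group_add \<Rightarrow> 'w"
    and p :: "'v \<Rightarrow> 'w \<Rightarrow> complex"
    and k :: "('v,'w) glel set"
  assumes "vector_space sV" and "vector_space sW"
    and "countable_dim sV" and "countable_dim sW"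
    and "nondeg_pairing sV sW p"
    and "gl_subalgebra sV sW p k"
  shows "\<exists>\<FF> \<GG>. taut_couple sV sW p \<FF> \<GG> \<and>
           k \<subseteq> StV sV sW p \<FF> \<inter> StW sV sW p \<GG> \<and>
           (\<forall>((F1,F2),(G1,G2)) \<in> taut_C p \<FF> \<GG>.
               irred_quot sV fst k F1 F2 \<and> irred_quot sW snd k G1 G2) \<and>
           lin_nilrad sV sW k = lin_nilrad sV sW (StV sV sW p \<FF> \<inter> StW sV sW p \<GG>) \<inter> k"
proof -
  interpret dual_pair sV sW p
    by (intro dual_pair.intro complex_space.intro dual_pair_axioms.intro assms)
  show ?thesis by (rule taut_couple_exists) (rule assms)
qed

end
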